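(* Let $n\ge 2$ and let $\sigma_1,\sigma_2,\ldots,\sigma_n$ be real numbers. Set $\overline{c}_l:=\sigma_1+\ldots+\sigma_l+l-1$ for $1\le l\le n$, and assume that for each $l=1,2,\ldots,n$, $$\overline{c}_l>0\quad\text{whenever}\quad \sigma_l\ne 0.$$ Let $1<q\le\frac{n}{n-1}$ and $b=\sigma_1-1+\frac{q-1}{q}n$. Then there exists a constant $C>0$ such that for every $w\in C_0^\infty(\mathbb{R}^n)$, $$\int_{\mathbb{R}^n}|x_1|^{\sigma_1}|\mathbf{X_2}|^{\sigma_2}\cdots|\mathbf{X_n}|^{\sigma_n}|\nabla w|\,dx\ \ge\ C\left(\int_{\mathbb{R}^n}\left(|x_1|^{b}|\mathbf{X_2}|^{\sigma_2}\cdots|\mathbf{X_n}|^{\sigma_n}|w|\right)^{q}dx\right)^{\frac1q}.$$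
   Context: For $x=(x_1,\ldots,x_n)\in\mathbb{R}^n$ and $1\le k\le n$, $\mathbf{X_k}:=(x_1,\ldots,x_k,0,\ldots,0)$, so $|\mathbf{X_k}|=(x_1^2+\ldots+x_k^2)^{1/2}$; in particular $|\mathbf{X_n}|=|x|$. *)

theory Defs
  imports "HOL-Analysis.Analysis"
begin

text \<open>
  A bijection \<open>e\<close> from \<open>{1..CARD('n)}\<close> onto the index type labels the coordinates of
  a point of \<open>real ^ 'n\<close>: \<open>x $ e i\<close> is the \<open>i\<close>-th coordinate.
  The vector below is \<open>(x\<^sub>1, \<dots>, x\<^sub>k, 0, \<dots>, 0)\<close>.
\<close>

definition head_part :: "(nat \<Rightarrow> 'n) \<Rightarrow> nat \<Rightarrow> real ^ 'n::finite \<Rightarrow> real ^ 'n" where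
  "head_part e k x = (\<chi> j. if j \<in> e ` {1..k} then x $ j else 0)"

primrec Ck_fun :: "nat \<Rightarrow> ('a::euclidean_space \<Rightarrow> real) \<Rightarrow> bool" where
  "Ck_fun 0 f \<longleftrightarrow> continuous_on UNIV f"
| "Ck_fun (Suc k) f \<longleftrightarrow>
     (\<forall>x. f differentiable (at x)) \<and> (\<forall>v. Ck_fun k (\<lambda>x. frechet_derivative f (at x) v))"

definition test_function :: "('a::euclidean_space \<Rightarrow> real) \<Rightarrow> bool" where
  "test_function f \<longleftrightarrow> (\<forall>k. Ck_fun k f) \<and> compact (closure {x. f x \<noteq> 0})"

definition grad :: "('a::euclidean_space \<Rightarrow> real) \<Rightarrow> 'a \<Rightarrow> 'a" where
  "grad f x = (THE D. GDERIV f x :> D)"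

text \<open>Real powers on \<open>[0, \<infinity>]\<close>, meant for positive exponents, so that \<open>\<infinity>\<close> is mapped to \<open>\<infinity>\<close>.\<close>

definition ennpowr :: "ennreal \<Rightarrow> real \<Rightarrow> ennreal" where
  "ennpowr x p = (if x = \<infinity> then \<infinity> else ennreal (enn2real x powr p))"

text \<open>
  In \<open>sobolev_weight\<close> the exponent of the first factor is a separate argument \<open>a\<close>;
  the exponents of the others are \<open>\<sigma> 2, \<dots>, \<sigma> n\<close>.
  The convention \<open>0 powr s = 0\<close> (also for \<open>s \<le> 0\<close>) affects this product only on the
  hyperplane \<open>x $ e 1 = 0\<close>, which is a null set.
\<close>

definition sobolev_weight ::
  "(nat \<Rightarrow> 'n) \<Rightarrow> real \<Rightarrow> (nat \<Rightarrow> real) \<Rightarrow> real ^ 'n::finite \<Rightarrow> real" where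
  "sobolev_weight e a \<sigma> x =
     \<bar>x $ e 1\<bar> powr a * (\<Prod>k=2..CARD('n). norm (head_part e k x) powr \<sigma> k)"

end

theory Submission
  imports Defs
begin

text \<open>
  Let \<open>W\<close> be the weight with all exponents \<open>\<sigma> k\<close> and put \<open>v = W w\<close>. The inequality for \<open>w\<close> is the
  unweighted one for \<open>v\<close>, with \<open>\<bar>x\<^sub>1\<bar>\<close> to the power \<open>b - \<sigma> 1\<close>, because
  \<open>\<bar>\<nabla>v\<bar> \<le> W \<bar>\<nabla>w\<bar> + \<Sum>\<^sub>k \<bar>\<sigma> k\<bar> W \<bar>w\<bar> / \<bar>X\<^sub>k\<bar>\<close> and the sum is controlled by Hardy inequalities obtained
  from the vector fields \<open>W X\<^sub>k / \<bar>X\<^sub>k\<bar>\<close>. The unweighted inequality holds since the measure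
  \<open>\<bar>x\<^sub>1\<bar>\<close> to the power \<open>(b - \<sigma> 1) q\<close> of a ball of radius \<open>r\<close> is at most a constant times \<open>r\<close> to the power
  \<open>(n - 1) q\<close>: this yields a weak-type bound for potentials of order one, and truncation
  upgrades it to a strong one. As \<open>W\<close> is smooth only off the hyperplane \<open>x\<^sub>1 = 0\<close>, all estimates
  are made on the half-spaces \<open>x\<^sub>1 > \<epsilon>\<close> and \<open>x\<^sub>1 < - \<epsilon>\<close>, with constants independent of \<open>\<epsilon>\<close>.
\<close>

section \<open>Potential estimates on half-spaces\<close>

text \<open>The Hardy step rests on the identity div(W X_l / |X_l|) = (W / |X_l|) (c_l + sum over k
  > l of \<sigma>_k |X_l|^2 / |X_k|^2) with c_l = \<sigma>_1 + ... + \<sigma>_l + l - 1. The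
  hypothesis makes c_l positive for exactly those l whose term occurs in the bound for |grad v|, and
  the error sum involves only Hardy integrals of larger index, so the estimates form a triangular
  system. The choice of b gives (b - \<sigma>_1) q = p with p = (n - 1) q - n. Here q > 1 means p >
  -1, which is local integrability of |x_1|^p, and q \<le> n / (n - 1) means p \<le> 0, which bounds
  |x_1|^p by r^p wherever |x_1| > r. Together they give ball growth r^(n + p) = r^((n - 1) q)
  uniformly in the centre. The obstacle is the hyperplane: W may blow up there or have a nonzero
  limit, so v has no controlled extension across it. Both the potential estimate and the Hardy
  estimate therefore have to work inside a half-space without using boundary values, which is
  achieved by moving points only away from the boundary.\<close>

lemma ray_bound:
  fixes f :: "'a::euclidean_space \<Rightarrow> real" and G :: "'a \<Rightarrow> 'a"
  assumes der: "\<And>y. \<epsilon> < y \<bullet> u \<Longrightarrow> (f has_derivative (\<lambda>h. G y \<bullet> h)) (at y)"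
    and cont: "continuous_on {y. \<epsilon> < y \<bullet> u} G"
    and supp: "\<And>y. R < norm y \<Longrightarrow> f y = 0"
    and x: "\<epsilon> < x \<bullet> u" and z: "0 < z \<bullet> u"
  shows "ennreal \<bar>f x\<bar> \<le>
    (\<integral>\<^sup>+r. ennreal (norm (G (x + r *\<^sub>R z)) * norm z) * indicator {0<..} r \<partial>lborel)"
proof -
  have z0: "norm z > 0" using z by auto
  \<comment> \<open>At time \<open>T\<close> the ray has left the ball of radius \<open>R\<close>,
    so \<open>f x\<close> is minus the integral of the derivative over
    \<open>{0..T}\<close>.\<close>
  define T where "T = (\<bar>R\<bar> + norm x + 1) / norm z"
  have T0: "T > 0" unfolding T_def using z0 by (intro divide_pos_pos add_nonneg_pos) auto
  have "norm (T *\<^sub>R z) = \<bar>R\<bar> + norm x + 1"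
    using z0 T0 unfolding norm_scaleR T_def by (simp add: abs_of_pos)
  moreover have "norm (T *\<^sub>R z) \<le> norm (x + T *\<^sub>R z) + norm x"
    by (metis add_diff_cancel_left' norm_triangle_ineq4)
  ultimately have "R < norm (x + T *\<^sub>R z)" by linarith
  then have fT: "f (x + T *\<^sub>R z) = 0" by (rule supp)
  have in_H: "\<epsilon> < (x + r *\<^sub>R z) \<bullet> u" if "r \<ge> 0" for r
    using x mult_nonneg_nonneg[OF that less_imp_le[OF z]] by (simp add: inner_add_left)
  have "((\<lambda>r. f (x + r *\<^sub>R z)) has_vector_derivative G (x + r *\<^sub>R z) \<bullet> z) (at r within {0..T})"
    if "r \<in> {0..T}" for r
  proof -
    have "((\<lambda>r. x + r *\<^sub>R z) has_derivative (\<lambda>h. h *\<^sub>R z)) (at r within {0..T})"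
      by (auto intro!: derivative_eq_intros)
    from has_derivative_compose[OF this der[OF in_H]] that show ?thesis
      by (simp add: has_vector_derivative_def)
  qed
  then have I: "((\<lambda>r. G (x + r *\<^sub>R z) \<bullet> z) has_integral (f (x + T *\<^sub>R z) - f (x + 0 *\<^sub>R z))) {0..T}"
    using T0 by (intro fundamental_theorem_of_calculus) auto
  have contG: "continuous_on {0..T} (\<lambda>r. G (x + r *\<^sub>R z))"
    by (rule continuous_on_compose2[OF cont]) (auto intro!: continuous_intros in_H)
  define k where "k r = norm (G (x + r *\<^sub>R z)) * norm z" for r
  have contk: "continuous_on {0..T} k"
    unfolding k_def by (intro continuous_intros contG)
  have kI: "(k has_integral integral {0..T} k) {0..T}"
    using integrable_continuous_interval[OF contk] by (rule integrable_integral)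
  have "\<bar>f x\<bar> = norm (integral {0..T} (\<lambda>r. G (x + r *\<^sub>R z) \<bullet> z))"
    using integral_unique[OF I] fT by simp
  also have "\<dots> \<le> integral {0..T} k"
    using I kI by (intro integral_norm_bound_integral)
      (auto simp: k_def integrable_on_def Cauchy_Schwarz_ineq2)
  finally have "ennreal \<bar>f x\<bar> \<le> ennreal (integral {0..T} k)" by (rule ennreal_leI)
  also have "\<dots> = (\<integral>\<^sup>+r. ennreal (k r) * indicator {0..T} r \<partial>lborel)"
    by (rule nn_integral_has_integral_lebesgue'[OF _ kI, symmetric]) (simp add: k_def)
  also have "\<dots> \<le> (\<integral>\<^sup>+r. ennreal (k r) * indicator {0<..} r \<partial>lborel)"
  proof (rule nn_integral_mono_AE)
    show "AE r in lborel. ennreal (k r) * indicator {0..T} r \<le> ennreal (k r) * indicator {0<..} r"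
      using AE_lborel_singleton[of 0] by eventually_elim (auto simp: indicator_def)
  qed
  finally show ?thesis unfolding k_def .
qed

lemma nn_integral_scale_translate:
  fixes g :: "'a::euclidean_space \<Rightarrow> ennreal"
  assumes [measurable]: "g \<in> borel_measurable borel" and r: "0 < r"
  shows "(\<integral>\<^sup>+z. g (x + r *\<^sub>R z) \<partial>lborel) = ennreal (r powr - real DIM('a)) * (\<integral>\<^sup>+y. g y \<partial>lborel)"
proof -
  have "(\<integral>\<^sup>+y. g y \<partial>lborel) =
      (\<integral>\<^sup>+y. g y \<partial>density (distr lborel borel (\<lambda>z. x + r *\<^sub>R z)) (\<lambda>_. ennreal (\<bar>r\<bar> ^ DIM('a))))"
    using lborel_affine[of r x] r by simp
  also have "\<dots> = ennreal (r ^ DIM('a)) * (\<integral>\<^sup>+z. g (x + r *\<^sub>R z) \<partial>lborel)"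
    using r by (simp add: nn_integral_density nn_integral_distr nn_integral_cmult)
  finally have *: "(\<integral>\<^sup>+y. g y \<partial>lborel) = ennreal (r ^ DIM('a)) * (\<integral>\<^sup>+z. g (x + r *\<^sub>R z) \<partial>lborel)" .
  have "ennreal (r powr - real DIM('a)) * ennreal (r ^ DIM('a)) = 1"
    using r by (simp add: ennreal_mult[symmetric] powr_minus powr_realpow)
  with * show ?thesis by (metis mult.assoc mult_1)
qed

text \<open>The directions along which a ray moves deeper into the half-space. Taking a solid half
  ball instead of a half sphere lets the average be formed with Lebesgue measure on the whole
  space.\<close>

definition half_ball :: "'a::euclidean_space \<Rightarrow> 'a set" where
  "half_ball u = {z. norm z \<le> 1 \<and> 0 < z \<bullet> u}"

lemma half_ball_measurable [measurable]: "half_ball u \<in> sets borel"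
  unfolding half_ball_def by measurable

lemma emeasure_half_ball:
  fixes u :: "'a::euclidean_space"
  assumes "u \<noteq> 0"
  shows "emeasure lborel (half_ball u) \<noteq> 0" "emeasure lborel (half_ball u) \<noteq> \<infinity>"
proof -
  let ?O = "ball 0 1 \<inter> {z. 0 < z \<bullet> u}"
  have O: "open ?O" by (intro open_Int open_ball open_Collect_less continuous_intros)
  have "(1/2) *\<^sub>R (u /\<^sub>R norm u) \<in> ?O" using assms by simp
  then have "?O \<noteq> {}" by blast
  then have "\<not> negligible ?O" using O open_not_negligible by blast
  then have "?O \<notin> null_sets lborel"
    using negligible_iff_null_sets null_sets_completionI by blast
  moreover have "?O \<in> sets lborel" using O by simp
  ultimately have "emeasure lborel ?O \<noteq> 0" by (auto simp: null_sets_def)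
  moreover have "emeasure lborel ?O \<le> emeasure lborel (half_ball u)"
    by (rule emeasure_mono) (auto simp: half_ball_def)
  ultimately show "emeasure lborel (half_ball u) \<noteq> 0" by auto
  have "bounded (half_ball u)"
    by (rule bounded_subset[of "cball 0 1"]) (auto simp: half_ball_def)
  then show "emeasure lborel (half_ball u) \<noteq> \<infinity>"
    using emeasure_bounded_finite by (metis infinity_ennreal_def less_irrefl)
qed

lemma measurable_norm_on_half_space:
  fixes G :: "'a::euclidean_space \<Rightarrow> 'a"
  assumes "continuous_on {y. \<epsilon> < y \<bullet> u} G"
  shows "(\<lambda>y. ennreal (norm (G y)) * indicator {y. \<epsilon> < y \<bullet> u} y) \<in> borel_measurable borel"
proof -
  let ?H = "{y. \<epsilon> < y \<bullet> u}"
  have "?H \<in> sets borel" by measurable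
  then have "(\<lambda>y. indicator ?H y *\<^sub>R G y) \<in> borel_measurable borel"
    using assms by (rule borel_measurable_continuous_on_indicator)
  then have "(\<lambda>y. ennreal (norm (indicator ?H y *\<^sub>R G y))) \<in> borel_measurable borel" by measurable
  also have "(\<lambda>y. ennreal (norm (indicator ?H y *\<^sub>R G y))) = (\<lambda>y. ennreal (norm (G y)) * indicator ?H y)"
    by (auto simp: indicator_def)
  finally show ?thesis .
qed

text \<open>Every ray from \<open>x\<close> in a direction of the half ball stays in the half-space; averaging over these
  directions replaces the Riesz potential representation and needs no extension of \<open>f\<close>.\<close>

lemma cone_bound:
  fixes f :: "'a::euclidean_space \<Rightarrow> real" and G :: "'a \<Rightarrow> 'a"
  assumes der: "\<And>y. \<epsilon> < y \<bullet> u \<Longrightarrow> (f has_derivative (\<lambda>h. G y \<bullet> h)) (at y)"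
    and cont: "continuous_on {y. \<epsilon> < y \<bullet> u} G"
    and supp: "\<And>y. R < norm y \<Longrightarrow> f y = 0"
    and x: "\<epsilon> < x \<bullet> u"
  shows "emeasure lborel (half_ball u) * ennreal \<bar>f x\<bar> \<le>
    (\<integral>\<^sup>+r. ennreal (r powr - real DIM('a)) * indicator {0<..} r *
       (\<integral>\<^sup>+y. ennreal (norm (G y)) * indicator {y. \<epsilon> < y \<bullet> u} y * indicator {y. dist x y \<le> r} y \<partial>lborel) \<partial>lborel)"
proof -
  let ?H = "{y. \<epsilon> < y \<bullet> u}"
  define g where "g y = ennreal (norm (G y)) * indicator ?H y" for y
  have Hs[measurable]: "?H \<in> sets borel" by measurable
  have g[measurable]: "g \<in> borel_measurable borel"
    using cont unfolding g_def by (rule measurable_norm_on_half_space)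
  have "emeasure lborel (half_ball u) * ennreal \<bar>f x\<bar> = (\<integral>\<^sup>+z. ennreal \<bar>f x\<bar> * indicator (half_ball u) z \<partial>lborel)"
    by (simp add: nn_integral_cmult_indicator mult.commute)
  also have "\<dots> \<le> (\<integral>\<^sup>+z. \<integral>\<^sup>+r. g (x + r *\<^sub>R z) * indicator {0<..} r * indicator (half_ball u) z \<partial>lborel \<partial>lborel)"
  proof (rule nn_integral_mono)
    fix z
    show "ennreal \<bar>f x\<bar> * indicator (half_ball u) z \<le>
      (\<integral>\<^sup>+r. g (x + r *\<^sub>R z) * indicator {0<..} r * indicator (half_ball u) z \<partial>lborel)"
    proof (cases "z \<in> half_ball u")
      case True
      then have z: "0 < z \<bullet> u" "norm z \<le> 1" by (auto simp: half_ball_def)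
      have "ennreal \<bar>f x\<bar> \<le> (\<integral>\<^sup>+r. ennreal (norm (G (x + r *\<^sub>R z)) * norm z) * indicator {0<..} r \<partial>lborel)"
        using der cont supp x z(1) by (rule ray_bound)
      also have "\<dots> \<le> (\<integral>\<^sup>+r. g (x + r *\<^sub>R z) * indicator {0<..} r \<partial>lborel)"
      proof (rule nn_integral_mono)
        fix r :: real
        have "\<epsilon> < (x + r *\<^sub>R z) \<bullet> u" if "r > 0"
          using x mult_pos_pos[OF that z(1)] by (simp add: inner_add_left)
        moreover have "norm (G (x + r *\<^sub>R z)) * norm z \<le> norm (G (x + r *\<^sub>R z))"
          using z by (simp add: mult_left_le)
        ultimately show "ennreal (norm (G (x + r *\<^sub>R z)) * norm z) * indicator {0<..} r
            \<le> g (x + r *\<^sub>R z) * indicator {0<..} r"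
          by (auto simp: g_def indicator_def intro!: ennreal_leI)
      qed
      finally show ?thesis using True by simp
    qed simp
  qed
  \<comment> \<open>For fixed \<open>r\<close>, substituting \<open>y = x + r z\<close> costs the
    factor \<open>r powr -d\<close> with \<open>d = DIM('a)\<close> and puts \<open>y\<close> in the
    ball of radius \<open>r\<close> about \<open>x\<close>. Integrating over \<open>r\<close> would
    turn this into the Riesz kernel \<open>dist x y powr (1 - d) / (d - 1)\<close>; the radial form
    is kept because the weak-type bound estimates each radius separately.\<close>
  also have "\<dots> = (\<integral>\<^sup>+r. \<integral>\<^sup>+z. g (x + r *\<^sub>R z) * indicator {0<..} r * indicator (half_ball u) z \<partial>lborel \<partial>lborel)"
    by (rule lborel_pair.Fubini') measurable
  also have "\<dots> \<le> (\<integral>\<^sup>+r. ennreal (r powr - real DIM('a)) * indicator {0<..} r *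
       (\<integral>\<^sup>+y. g y * indicator {y. dist x y \<le> r} y \<partial>lborel) \<partial>lborel)"
  proof (rule nn_integral_mono)
    fix r :: real
    show "(\<integral>\<^sup>+z. g (x + r *\<^sub>R z) * indicator {0<..} r * indicator (half_ball u) z \<partial>lborel)
      \<le> ennreal (r powr - real DIM('a)) * indicator {0<..} r *
       (\<integral>\<^sup>+y. g y * indicator {y. dist x y \<le> r} y \<partial>lborel)"
    proof (cases "r > 0")
      case True
      have "(\<integral>\<^sup>+z. g (x + r *\<^sub>R z) * indicator {0<..} r * indicator (half_ball u) z \<partial>lborel)
        \<le> (\<integral>\<^sup>+z. g (x + r *\<^sub>R z) * indicator {y. dist x y \<le> r} (x + r *\<^sub>R z) \<partial>lborel)"
        using True by (intro nn_integral_mono) (auto simp: indicator_def half_ball_def dist_norm)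
      also have "\<dots> = ennreal (r powr - real DIM('a)) * (\<integral>\<^sup>+y. g y * indicator {y. dist x y \<le> r} y \<partial>lborel)"
        using True by (intro nn_integral_scale_translate) measurable
      finally show ?thesis using True by simp
    qed simp
  qed
  finally show ?thesis unfolding g_def .
qed

section \<open>The weak-type bound\<close>

text \<open>The radius \<open>r0\<close> is where the two entries of the minimum agree. Below it the
  power is used, integrable at 0 because \<open>\<beta> > d - 1\<close>; above it the constant
  \<open>m\<close> is used, integrable at infinity because \<open>d > 1\<close>. Both pieces are
  multiples of \<open>m * r0 powr (1 - d)\<close>.\<close>

lemma nn_integral_powr_min_le:
  fixes A \<beta> d m :: real
  assumes "A > 0" "d > 1" "\<beta> > d - 1" "m > 0"
  defines "r0 \<equiv> (m / A) powr (1 / \<beta>)"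
  shows "(\<integral>\<^sup>+r. ennreal (r powr - d) * indicator {0<..} r * ennreal (min m (A * r powr \<beta>)) \<partial>lborel)
    \<le> ennreal (m * r0 powr (1 - d) * (1 / (\<beta> - d + 1) + 1 / (d - 1)))"
proof -
  have r0: "r0 > 0" and \<beta>: "\<beta> > 0" using assms by (auto simp: r0_def)
  have r0\<beta>: "A * r0 powr \<beta> = m"
    using assms \<beta> by (simp add: r0_def powr_powr)
  have I1: "((\<lambda>r. A * r powr (\<beta> - d)) has_integral A * (r0 powr (\<beta> - d + 1) / (\<beta> - d + 1))) {0..r0}"
    using r0 assms by (intro has_integral_mult_right has_integral_powr_from_0) auto
  have I2: "((\<lambda>r. m * r powr (-d)) has_integral m * (- (r0 powr (-d+1)) / (-d+1))) {r0..}"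
    using r0 assms by (intro has_integral_mult_right has_integral_powr_to_inf) auto
  have "(\<integral>\<^sup>+r. ennreal (r powr - d) * indicator {0<..} r * ennreal (min m (A * r powr \<beta>)) \<partial>lborel)
    \<le> (\<integral>\<^sup>+r. ennreal (A * r powr (\<beta> - d)) * indicator {0..r0} r +
          ennreal (m * r powr (-d)) * indicator {r0..} r \<partial>lborel)"
  proof (rule nn_integral_mono)
    fix r :: real
    have "r powr - d * min m (A * r powr \<beta>) \<le> A * r powr (\<beta> - d)" if "r > 0"
    proof -
      have "r powr - d * min m (A * r powr \<beta>) \<le> r powr - d * (A * r powr \<beta>)"
        by (intro mult_left_mono) auto
      also have "\<dots> = A * r powr (\<beta> - d)" using that by (simp add: powr_diff powr_minus field_simps)
      finally show ?thesis .
    qed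
    moreover have "r powr - d * min m (A * r powr \<beta>) \<le> m * r powr - d"
      by (metis min.cobounded1 mult.commute mult_left_mono powr_ge_zero)
    ultimately show "ennreal (r powr - d) * indicator {0<..} r * ennreal (min m (A * r powr \<beta>))
      \<le> ennreal (A * r powr (\<beta> - d)) * indicator {0..r0} r + ennreal (m * r powr (-d)) * indicator {r0..} r"
      using r0 assms by (cases "r > 0"; cases "r \<le> r0")
        (auto simp: indicator_def ennreal_mult[symmetric] intro!: ennreal_leI order_trans[OF _ add_increasing2])
  qed
  also have "\<dots> = (\<integral>\<^sup>+r. ennreal (A * r powr (\<beta> - d)) * indicator {0..r0} r \<partial>lborel) +
       (\<integral>\<^sup>+r. ennreal (m * r powr (-d)) * indicator {r0..} r \<partial>lborel)"
    by (rule nn_integral_add) auto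
  also have "\<dots> = ennreal (A * (r0 powr (\<beta> - d + 1) / (\<beta> - d + 1))) + ennreal (m * (- (r0 powr (-d+1)) / (-d+1)))"
    using assms nn_integral_has_integral_lebesgue'[OF _ I1] nn_integral_has_integral_lebesgue'[OF _ I2] by simp
  also have "\<dots> = ennreal (A * (r0 powr (\<beta> - d + 1) / (\<beta> - d + 1)) + m * (r0 powr (-d+1) / (d-1)))"
  proof -
    have "- (r0 powr (-d+1)) / (-d+1) = r0 powr (-d+1) / (d-1)"
      by (metis minus_diff_eq minus_divide_divide uminus_add_conv_diff)
    then show ?thesis using assms by (simp add: ennreal_plus)
  qed
  also have "A * (r0 powr (\<beta> - d + 1) / (\<beta> - d + 1)) = m * r0 powr (1 - d) / (\<beta> - d + 1)"
  proof -
    have "r0 powr (\<beta> - d + 1) = r0 powr \<beta> * r0 powr (1 - d)"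
      by (simp add: powr_add[symmetric] add_diff_eq diff_add_eq)
    then show ?thesis using r0\<beta> by (metis mult.assoc times_divide_eq_right)
  qed
  finally show ?thesis by (simp add: algebra_simps)
qed

text \<open>The pointwise cone bound is integrated over \<open>E\<close> with respect to
  \<open>M\<close>. The part of \<open>E\<close> in a ball of radius \<open>r\<close> has measure at
  most \<open>min m (A * r powr \<beta>)\<close>, and the resulting radial integral carries a factor
  \<open>m\<close> that cancels against the left side, leaving a negative power of \<open>m\<close>.
  Level 1 suffices because the truncations used later are normalised to it.\<close>

lemma weak_type_bound:
  fixes f :: "'a::euclidean_space \<Rightarrow> real" and G :: "'a \<Rightarrow> 'a"
  assumes der: "\<And>y. \<epsilon> < y \<bullet> u \<Longrightarrow> (f has_derivative (\<lambda>h. G y \<bullet> h)) (at y)"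
    and cont: "continuous_on {y. \<epsilon> < y \<bullet> u} G"
    and supp: "\<And>y. R < norm y \<Longrightarrow> f y = 0"
    and u: "u \<noteq> 0" and dim: "DIM('a) \<ge> 2"
    and M: "sets M = sets borel" "sigma_finite_measure M"
    and growth: "\<And>y r. 0 < r \<Longrightarrow> emeasure M {x. dist x y \<le> r} \<le> ennreal (A * r powr \<beta>)"
    and A: "A > 0" and \<beta>: "\<beta> > real DIM('a) - 1"
    and E: "E \<in> sets borel" "\<And>x. x \<in> E \<Longrightarrow> \<epsilon> < x \<bullet> u" "\<And>x. x \<in> E \<Longrightarrow> 1 \<le> \<bar>f x\<bar>"
    and m: "emeasure M E = ennreal m" "m \<ge> 0"
    and J: "(\<integral>\<^sup>+y. ennreal (norm (G y)) * indicator {y. \<epsilon> < y \<bullet> u} y \<partial>lborel) \<le> ennreal J" "J \<ge> 0"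
  shows "m powr ((real DIM('a) - 1) / \<beta>) \<le>
    A powr ((real DIM('a) - 1) / \<beta>) * (1 / (\<beta> - real DIM('a) + 1) + 1 / (real DIM('a) - 1))
      / measure lborel (half_ball u) * J"
    (is "_ \<le> ?K * J")
proof (cases "m = 0")
  case True
  have "0 \<le> 1 / (\<beta> - real DIM('a) + 1) + 1 / (real DIM('a) - 1)"
    by (rule add_nonneg_nonneg; rule divide_nonneg_pos) (use \<beta> dim in linarith)+
  then have "?K \<ge> 0" using measure_nonneg powr_ge_zero by (intro divide_nonneg_nonneg mult_nonneg_nonneg)
  from mult_nonneg_nonneg[OF this J(2)] show ?thesis using True by simp
next
  case False
  then have m0: "m > 0" using m by simp
  define d where "d = real DIM('a)"
  have d: "d > 1" using dim by (simp add: d_def)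
  have \<beta>0: "\<beta> > 0" using \<beta> d by (simp add: d_def)
  let ?H = "{y. \<epsilon> < y \<bullet> u}"
  define Z where "Z = measure lborel (half_ball u)"
  have Z: "emeasure lborel (half_ball u) = ennreal Z" "Z > 0"
    using emeasure_half_ball[OF u] unfolding Z_def
    by (auto simp: emeasure_eq_ennreal_measure zero_less_measure_iff)
  interpret M: sigma_finite_measure M by fact
  interpret P: pair_sigma_finite M "lborel :: real measure" by standard
  interpret Q: pair_sigma_finite M "lborel :: 'a measure" by standard
  define g where "g y = ennreal (norm (G y)) * indicator ?H y" for y
  have Hs[measurable]: "?H \<in> sets borel" by measurable
  have g[measurable]: "g \<in> borel_measurable borel"
    using cont unfolding g_def by (rule measurable_norm_on_half_space)
  note [measurable_cong] = M(1)
  note [measurable] = E(1)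
  define \<phi> where "\<phi> r = ennreal (r powr - d) * indicator {0<..} r" for r :: real
  have [measurable]: "\<phi> \<in> borel_measurable borel" unfolding \<phi>_def by measurable
  have "ennreal (Z * m) = (\<integral>\<^sup>+x. ennreal Z * indicator E x \<partial>M)"
    using Z m by (simp add: nn_integral_cmult_indicator ennreal_mult)
  also have "\<dots> \<le> (\<integral>\<^sup>+x. \<integral>\<^sup>+r. indicator E x * (\<phi> r * (\<integral>\<^sup>+y. g y * indicator {y. dist x y \<le> r} y \<partial>lborel)) \<partial>lborel \<partial>M)"
  proof (rule nn_integral_mono)
    fix x
    show "ennreal Z * indicator E x \<le> (\<integral>\<^sup>+r. indicator E x * (\<phi> r * (\<integral>\<^sup>+y. g y * indicator {y. dist x y \<le> r} y \<partial>lborel)) \<partial>lborel)"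
    proof (cases "x \<in> E")
      case True
      have "ennreal Z * ennreal 1 \<le> ennreal Z * ennreal \<bar>f x\<bar>"
        using E(3)[OF True] by (intro mult_left_mono ennreal_leI) auto
      also have "\<dots> \<le> (\<integral>\<^sup>+r. \<phi> r * (\<integral>\<^sup>+y. g y * indicator {y. dist x y \<le> r} y \<partial>lborel) \<partial>lborel)"
        using cone_bound[of \<epsilon> u f G R x, OF der cont supp E(2)[OF True]]
        unfolding Z(1) g_def \<phi>_def d_def by simp
      finally show ?thesis using True by simp
    qed simp
  qed
  also have "\<dots> = (\<integral>\<^sup>+r. \<integral>\<^sup>+x. indicator E x * (\<phi> r * (\<integral>\<^sup>+y. g y * indicator {y. dist x y \<le> r} y \<partial>lborel)) \<partial>M \<partial>lborel)"
    unfolding indicator_def mem_Collect_eq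
    by (rule P.Fubini'[symmetric]) measurable
  also have "\<dots> \<le> (\<integral>\<^sup>+r. ennreal J * (\<phi> r * ennreal (min m (A * r powr \<beta>))) \<partial>lborel)"
  proof (rule nn_integral_mono)
    fix r :: real
    show "(\<integral>\<^sup>+x. indicator E x * (\<phi> r * (\<integral>\<^sup>+y. g y * indicator {y. dist x y \<le> r} y \<partial>lborel)) \<partial>M)
      \<le> ennreal J * (\<phi> r * ennreal (min m (A * r powr \<beta>)))"
    proof (cases "r > 0")
      case True
      have "(\<integral>\<^sup>+x. indicator E x * (\<phi> r * (\<integral>\<^sup>+y. g y * indicator {y. dist x y \<le> r} y \<partial>lborel)) \<partial>M)
        = \<phi> r * (\<integral>\<^sup>+x. (\<integral>\<^sup>+y. g y * (indicator E x * indicator {y. dist x y \<le> r} y) \<partial>lborel) \<partial>M)"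
        (is "_ = \<phi> r * ?I")
        unfolding indicator_def mem_Collect_eq
        by (subst nn_integral_cmult[symmetric], measurable)
          (auto simp: nn_integral_cmult[symmetric] ac_simps intro!: nn_integral_cong)
      also have "\<dots> \<le> \<phi> r * (ennreal J * ennreal (min m (A * r powr \<beta>)))"
      proof (rule mult_left_mono)
        \<comment> \<open>With the \<open>M\<close>-integral innermost, only the measure of
          \<open>E\<close> inside a ball about \<open>y\<close> remains, and its bound does not
          depend on \<open>y\<close>; what is left of the gradient is its full integral.\<close>
        have "?I = (\<integral>\<^sup>+y. (\<integral>\<^sup>+x. g y * (indicator E x * indicator {y. dist x y \<le> r} y) \<partial>M) \<partial>lborel)"
          unfolding indicator_def mem_Collect_eq
          by (rule Q.Fubini'[symmetric]) measurable
        also have "\<dots> \<le> (\<integral>\<^sup>+y. g y * ennreal (min m (A * r powr \<beta>)) \<partial>lborel)"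
        proof (rule nn_integral_mono)
          fix y
          have S: "{x. dist x y \<le> r} \<in> sets M" unfolding M by measurable
          have "(\<integral>\<^sup>+x. g y * (indicator E x * indicator {y. dist x y \<le> r} y) \<partial>M)
            = g y * (\<integral>\<^sup>+x. indicator (E \<inter> {x. dist x y \<le> r}) x \<partial>M)"
            using S by (subst nn_integral_cmult[symmetric]) (auto simp: indicator_def intro!: nn_integral_cong)
          also have "\<dots> = g y * emeasure M (E \<inter> {x. dist x y \<le> r})"
            using S by simp
          also have "\<dots> \<le> g y * ennreal (min m (A * r powr \<beta>))"
          proof (intro mult_left_mono)
            have "emeasure M (E \<inter> {x. dist x y \<le> r}) \<le> ennreal m"
              unfolding m(1)[symmetric] by (intro emeasure_mono) auto
            moreover have "emeasure M (E \<inter> {x. dist x y \<le> r}) \<le> ennreal (A * r powr \<beta>)"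
              using S by (intro order_trans[OF _ growth[OF True]] emeasure_mono) auto
            ultimately show "emeasure M (E \<inter> {x. dist x y \<le> r}) \<le> ennreal (min m (A * r powr \<beta>))"
              by (auto simp: min_def)
          qed simp
          finally show "(\<integral>\<^sup>+x. g y * (indicator E x * indicator {y. dist x y \<le> r} y) \<partial>M)
            \<le> g y * ennreal (min m (A * r powr \<beta>))" .
        qed
        also have "\<dots> = (\<integral>\<^sup>+y. g y \<partial>lborel) * ennreal (min m (A * r powr \<beta>))"
          by (rule nn_integral_multc) simp
        also have "\<dots> \<le> ennreal J * ennreal (min m (A * r powr \<beta>))"
          using J(1) unfolding g_def by (rule mult_right_mono) simp
        finally show "?I \<le> ennreal J * ennreal (min m (A * r powr \<beta>))" .
      qed simp
      finally show ?thesis by (simp add: ac_simps)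
    qed (simp add: \<phi>_def)
  qed
  also have "\<dots> = ennreal J * (\<integral>\<^sup>+r. \<phi> r * ennreal (min m (A * r powr \<beta>)) \<partial>lborel)"
    by (rule nn_integral_cmult) measurable
  also have "\<dots> \<le> ennreal J * ennreal (m * ((m / A) powr (1 / \<beta>)) powr (1 - d) * (1 / (\<beta> - d + 1) + 1 / (d - 1)))"
    unfolding \<phi>_def using nn_integral_powr_min_le[OF A d _ m0, of \<beta>] \<beta>
    by (intro mult_left_mono) (auto simp: d_def)
  also have "\<dots> = ennreal (J * (m * ((m / A) powr (1 / \<beta>)) powr (1 - d) * (1 / (\<beta> - d + 1) + 1 / (d - 1))))"
    using J(2) m0 d \<beta> by (intro ennreal_mult[symmetric]) (auto simp: d_def)
  finally have "Z * m \<le> J * (m * ((m / A) powr (1 / \<beta>)) powr (1 - d) * (1 / (\<beta> - d + 1) + 1 / (d - 1)))"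
    using J(2) m0 d \<beta> by (subst (asm) ennreal_le_iff) (auto simp: d_def)
  \<comment> \<open>Here \<open>m > 0\<close> is cancelled, and \<open>r0 powr (1 - d)\<close> is
    rewritten as a power of \<open>m / A\<close>.\<close>
  then have *: "Z \<le> J * (m / A) powr (- ((d - 1) / \<beta>)) * (1 / (\<beta> - d + 1) + 1 / (d - 1))"
    using m0 by (simp add: powr_powr minus_divide_left)
  have "(m / A) powr ((d - 1) / \<beta>) * Z \<le> (m / A) powr ((d - 1) / \<beta>) * (J * (m / A) powr (- ((d - 1) / \<beta>)) * (1 / (\<beta> - d + 1) + 1 / (d - 1)))"
    using * by (rule mult_left_mono) simp
  also have "\<dots> = (m / A) powr ((d - 1) / \<beta>) * (m / A) powr (- ((d - 1) / \<beta>)) * (J * (1 / (\<beta> - d + 1) + 1 / (d - 1)))"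
    by (simp only: ac_simps)
  also have "(m / A) powr ((d - 1) / \<beta>) * (m / A) powr (- ((d - 1) / \<beta>)) = 1"
    using m0 A by (simp add: powr_add[symmetric])
  finally have "m powr ((d - 1) / \<beta>) / A powr ((d - 1) / \<beta>) * Z \<le> J * (1 / (\<beta> - d + 1) + 1 / (d - 1))"
    using m0 A by (simp add: powr_divide)
  then have "m powr ((d - 1) / \<beta>) \<le> J * (1 / (\<beta> - d + 1) + 1 / (d - 1)) / Z * A powr ((d - 1) / \<beta>)"
    using Z A by (simp add: field_simps)
  then show ?thesis unfolding d_def Z_def by (simp add: ac_simps)
qed

section \<open>From weak type to strong type\<close>

text \<open>A continuously differentiable cutoff meant for the argument
  \<open>(f / \<lambda>)^2\<close>: the thresholds 1 and 4 are the squares of 1 and 2. Its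
  derivative is a quadratic bump cut off at zero, with maximum 9/4.\<close>

lemma smooth_truncation:
  obtains \<Phi> \<phi> :: "real \<Rightarrow> real" where
    "\<And>t. 0 \<le> t \<Longrightarrow> (\<Phi> has_real_derivative \<phi> t) (at t)" "continuous_on UNIV \<phi>" "\<Phi> 0 = 0"
    "\<And>t. 4 \<le> t \<Longrightarrow> 1 \<le> \<Phi> t" "\<And>t. 0 \<le> \<phi> t" "\<And>t. \<phi> t \<le> 3"
    "\<And>t. \<not> (1 < t \<and> t < 4) \<Longrightarrow> \<phi> t = 0"
proof -
  define \<phi> where "\<phi> t = max 0 ((t - 1) * (4 - t))" for t :: real
  \<comment> \<open>Starting at -1 makes 0 an interior point, so the derivative at 0 is two-sided;
    \<open>\<Phi> 0 = 0\<close> survives because \<open>\<phi>\<close> vanishes on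
    \<open>{-1..0}\<close>.\<close>
  define \<Phi> where "\<Phi> t = integral {-1..t} \<phi>" for t :: real
  have cont: "continuous_on UNIV \<phi>" unfolding \<phi>_def by (intro continuous_intros)
  then have cont': "continuous_on S \<phi>" for S using continuous_on_subset by blast
  have nonneg: "0 \<le> \<phi> t" for t by (simp add: \<phi>_def)
  have "4 * ((t - 1) * (4 - t)) = 9 - (2 * t - 5)^2" for t :: real
    by (simp add: power2_eq_square algebra_simps)
  then have "4 * ((t - 1) * (4 - t)) \<le> 9" for t :: real by simp
  then have le3: "\<phi> t \<le> 3" for t
    unfolding \<phi>_def using \<open>\<And>t. 4 * ((t - 1) * (4 - t)) \<le> 9\<close>[of t] by linarith
  have zero: "\<phi> t = 0" if "\<not> (1 < t \<and> t < 4)" for t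
    using that by (auto simp: \<phi>_def max_def mult_le_0_iff zero_le_mult_iff not_less)
  have \<Phi>0: "\<Phi> 0 = 0"
  proof -
    have "(\<phi> has_integral 0) {-1..0}" by (rule has_integral_is_0) (simp add: zero)
    then have "integral {-1..0} \<phi> = 0" by (rule integral_unique)
    then show ?thesis by (simp add: \<Phi>_def)
  qed
  have der: "(\<Phi> has_real_derivative \<phi> t) (at t)" if "0 \<le> t" for t
  proof -
    have "(\<Phi> has_real_derivative \<phi> t) (at t within {-1..t+1})"
      unfolding \<Phi>_def using that by (intro integral_has_real_derivative cont') auto
    moreover have "t \<in> interior {-1..t+1}" using that by simp
    ultimately show ?thesis by (metis at_within_interior)
  qed
  have ge1: "1 \<le> \<Phi> t" if "4 \<le> t" for t
  proof -
    have "1 = integral {2..3::real} (\<lambda>_. 1 :: real)" by simp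
    also have "\<dots> \<le> integral {2..3} \<phi>"
    proof (intro integral_le integrable_continuous_interval cont' continuous_intros)
      fix t :: real assume "t \<in> {2..3}"
      then have "1 * 1 \<le> (t - 1) * (4 - t)" by (intro mult_mono) auto
      then show "1 \<le> \<phi> t" by (simp add: \<phi>_def)
    qed
    also have "\<dots> \<le> \<Phi> t"
      unfolding \<Phi>_def using that nonneg
      by (intro integral_subset_le integrable_continuous_interval cont') auto
    finally show ?thesis .
  qed
  show ?thesis
    using that[of \<Phi> \<phi>] der cont \<Phi>0 ge1 nonneg le3 zero by blast
qed

text \<open>Maz'ya's truncation argument: applying the weak-type bound to smooth truncations of \<open>f\<close>
  at the levels \<open>2\<^sup>k\<close> gives a strong-type bound, because the gradients of the truncations
  have disjoint supports and \<open>q > 1\<close>.\<close>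

lemma strong_type_bound:
  fixes f :: "'a::euclidean_space \<Rightarrow> real" and G :: "'a \<Rightarrow> 'a"
  assumes der: "\<And>y. \<epsilon> < y \<bullet> u \<Longrightarrow> (f has_derivative (\<lambda>h. G y \<bullet> h)) (at y)"
    and cont: "continuous_on {y. \<epsilon> < y \<bullet> u} G"
    and supp: "\<And>y. R < norm y \<Longrightarrow> f y = 0"
    and f[measurable]: "f \<in> borel_measurable borel"
    and u: "u \<noteq> 0" and dim: "DIM('a) \<ge> 2"
    and M: "sets M = sets borel" "sigma_finite_measure M"
    and q: "q > 1"
    and growth: "\<And>y r. 0 < r \<Longrightarrow>
      emeasure M {x. dist x y \<le> r} \<le> ennreal (A * r powr ((real DIM('a) - 1) * q))"
    and A: "A > 0"
    and K: "K = A powr (1 / q) * (1 / ((real DIM('a) - 1) * q - real DIM('a) + 1) + 1 / (real DIM('a) - 1))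
      / measure lborel (half_ball u)"
    and J: "(\<integral>\<^sup>+y. ennreal (norm (G y)) * indicator {y. \<epsilon> < y \<bullet> u} y \<partial>lborel) \<le> ennreal J" "J \<ge> 0"
  shows "(\<integral>\<^sup>+x. ennreal (\<bar>f x\<bar> powr q) * indicator {y. \<epsilon> < y \<bullet> u} x \<partial>M) \<le> ennreal ((48 * K * J) powr q)"
proof -
  define d where "d = real DIM('a)"
  have d: "d > 1" using dim by (simp add: d_def)
  define \<beta> where "\<beta> = (d - 1) * q"
  have \<beta>: "\<beta> > d - 1" using d q by (simp add: \<beta>_def)
  have \<theta>: "(d - 1) / \<beta> = 1 / q" using d by (simp add: \<beta>_def)
  have "0 \<le> 1 / (\<beta> - d + 1) + 1 / (d - 1)"
    by (rule add_nonneg_nonneg; rule divide_nonneg_pos) (use \<beta> d in linarith)+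
  then have K0: "K \<ge> 0" unfolding K d_def[symmetric] \<beta>_def[symmetric]
    using measure_nonneg powr_ge_zero by (intro divide_nonneg_nonneg mult_nonneg_nonneg)
  let ?H = "{y. \<epsilon> < y \<bullet> u}"
  note [measurable_cong] = M(1)
  define g where "g y = ennreal (norm (G y)) * indicator ?H y" for y
  have Hs[measurable]: "?H \<in> sets borel" by measurable
  have g[measurable]: "g \<in> borel_measurable borel"
    using cont unfolding g_def by (rule measurable_norm_on_half_space)
  obtain \<Phi> \<phi> where \<Phi>: "\<And>t. 0 \<le> t \<Longrightarrow> (\<Phi> has_real_derivative \<phi> t) (at t)" "continuous_on UNIV \<phi>" "\<Phi> 0 = 0"
    "\<And>t. 4 \<le> t \<Longrightarrow> 1 \<le> \<Phi> t" "\<And>t. 0 \<le> \<phi> t" "\<And>t. \<phi> t \<le> 3"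
    "\<And>t. \<not> (1 < t \<and> t < 4) \<Longrightarrow> \<phi> t = 0"
    using smooth_truncation by blast
  define lam where "lam k = (2::real) powi k" for k :: int
  have lam_powr: "lam k = 2 powr k" for k by (simp add: lam_def powr_real_of_int')
  have lam: "lam k > 0" for k by (simp add: lam_def)
  then have [simp]: "lam k \<noteq> 0" for k using less_irrefl by metis
  \<comment> \<open>The truncation at level \<open>lam k\<close> has its gradient on the shell
    \<open>B k\<close> and is at least 1 on \<open>E k\<close>.\<close>
  define B where "B k = {y. lam k < \<bar>f y\<bar> \<and> \<bar>f y\<bar> < 2 * lam k}" for k
  define E where "E k = {y \<in> ?H. 2 * lam k \<le> \<bar>f y\<bar>}" for k
  have B[measurable]: "B k \<in> sets borel" for k unfolding B_def by measurable
  have E[measurable]: "E k \<in> sets borel" for k unfolding E_def by measurable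
  define a where "a k = (\<integral>\<^sup>+y. g y * indicator (B k) y \<partial>lborel)" for k
  have aJ: "a k \<le> ennreal J" for k
  proof -
    have "a k \<le> (\<integral>\<^sup>+y. g y \<partial>lborel)"
      unfolding a_def by (intro nn_integral_mono) (auto simp: indicator_def)
    then show ?thesis using J(1) unfolding g_def by simp
  qed
  define b where "b k = enn2real (a k)" for k
  have ab: "a k = ennreal (b k)" for k
    unfolding b_def using aJ[of k] by (auto simp: ennreal_enn2real_if top_unique)
  have b0: "b k \<ge> 0" for k by (simp add: b_def)
  have bJ: "b k \<le> J" for k using aJ[of k] J(2) unfolding ab by simp
  \<comment> \<open>The weak-type bound is applied to the truncation \<open>F\<close>, so that only
    the part \<open>b k\<close> of the gradient integral carried by the shell enters. Replacing it
    by \<open>J\<close> here would lose summability over \<open>k\<close>.\<close>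
  have mE: "emeasure M (E k) \<le> ennreal ((12 * K * b k / lam k) powr q)" for k
  proof -
    \<comment> \<open>The square, in place of the absolute value, keeps \<open>F\<close>
      differentiable where \<open>f\<close> vanishes.\<close>
    define F where "F y = \<Phi> ((f y)\<^sup>2 / (lam k)\<^sup>2)" for y
    define D where "D y = (\<phi> ((f y)\<^sup>2 / (lam k)\<^sup>2) * (2 * f y / (lam k)\<^sup>2)) *\<^sub>R G y" for y
    have derF: "(F has_derivative (\<lambda>h. D y \<bullet> h)) (at y)" if "\<epsilon> < y \<bullet> u" for y
    proof -
      let ?t = "(f y)\<^sup>2 / (lam k)\<^sup>2"
      have "((\<lambda>t. t\<^sup>2 / (lam k)\<^sup>2) has_real_derivative 2 * f y / (lam k)\<^sup>2) (at (f y))"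
        by (auto intro!: derivative_eq_intros simp: power2_eq_square power4_eq_xxxx)
      then have "((\<lambda>t. t\<^sup>2 / (lam k)\<^sup>2) has_derivative (\<lambda>h. 2 * f y / (lam k)\<^sup>2 * h)) (at (f y))"
        by (simp only: has_field_derivative_def)
      from has_derivative_compose[OF der[OF that] this]
      have 1: "((\<lambda>y. (f y)\<^sup>2 / (lam k)\<^sup>2) has_derivative (\<lambda>h. 2 * f y / (lam k)\<^sup>2 * (G y \<bullet> h))) (at y)" .
      have 2: "(\<Phi> has_derivative (\<lambda>h. \<phi> ?t * h)) (at ?t)"
        using \<Phi>(1)[of ?t] by (simp add: has_field_derivative_def)
      show ?thesis
        using has_derivative_compose[OF 1 2] unfolding F_def D_def inner_scaleR_left
        by (simp only: mult.assoc)
    qed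
    have cf: "continuous_on ?H f"
      using der by (auto intro!: continuous_at_imp_continuous_on has_derivative_continuous)
    have contD: "continuous_on ?H D"
      unfolding D_def using lam[of k]
      by (intro continuous_intros cf cont continuous_on_compose2[OF \<Phi>(2)]) auto
    have suppF: "F y = 0" if "R < norm y" for y
      using supp[OF that] by (simp add: F_def \<Phi>(3))
    have F1: "1 \<le> \<bar>F y\<bar>" if "y \<in> E k" for y
    proof -
      have "2 * lam k \<le> \<bar>f y\<bar>" using that by (simp add: E_def)
      then have "(2 * lam k)\<^sup>2 \<le> \<bar>f y\<bar>\<^sup>2" using lam[of k] by (intro power_mono) auto
      then have "4 \<le> (f y)\<^sup>2 / (lam k)\<^sup>2" using lam[of k] by (simp add: field_simps power2_eq_square)
      then show ?thesis using \<Phi>(4) unfolding F_def by fastforce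
    qed
    \<comment> \<open>The constant is 3 * 2 * 2: the bound on \<open>\<phi>\<close>, the factor from
      differentiating the square, and \<open>\<bar>f y\<bar> < 2 * lam k\<close> on the
      shell.\<close>
    have Dle: "norm (D y) \<le> 12 / lam k * (norm (G y) * indicator (B k) y)" for y
    proof (cases "y \<in> B k")
      case True
      then have "\<bar>f y\<bar> \<le> 2 * lam k" by (simp add: B_def)
      then have "\<bar>\<phi> ((f y)\<^sup>2 / (lam k)\<^sup>2)\<bar> * (2 * \<bar>f y\<bar> / (lam k)\<^sup>2) \<le> 3 * (2 * (2 * lam k) / (lam k)\<^sup>2)"
        using \<Phi>(5,6) lam[of k] by (intro mult_mono divide_right_mono) auto
      also have "\<dots> = 12 / lam k" using lam[of k] by (simp add: power2_eq_square)
      finally have "\<bar>\<phi> ((f y)\<^sup>2 / (lam k)\<^sup>2)\<bar> * (2 * \<bar>f y\<bar> / (lam k)\<^sup>2) * norm (G y) \<le> 12 / lam k * norm (G y)"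
        by (rule mult_right_mono) simp
      then show ?thesis using True by (simp add: D_def abs_mult)
    next
      case False
      have "\<not> (1 < (f y)\<^sup>2 / (lam k)\<^sup>2 \<and> (f y)\<^sup>2 / (lam k)\<^sup>2 < 4)"
      proof
        assume "1 < (f y)\<^sup>2 / (lam k)\<^sup>2 \<and> (f y)\<^sup>2 / (lam k)\<^sup>2 < 4"
        then have "(lam k)\<^sup>2 < \<bar>f y\<bar>\<^sup>2" "\<bar>f y\<bar>\<^sup>2 < (2 * lam k)\<^sup>2"
          using lam[of k] by (auto simp: field_simps power2_eq_square)
        then have "lam k < \<bar>f y\<bar>" "\<bar>f y\<bar> < 2 * lam k"
          using lam[of k] power2_less_imp_less[of "lam k" "\<bar>f y\<bar>"]
            power2_less_imp_less[of "\<bar>f y\<bar>" "2 * lam k"] by simp_all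
        then show False using False by (simp add: B_def)
      qed
      then show ?thesis using \<Phi>(7) False by (simp add: D_def)
    qed
    have JD: "(\<integral>\<^sup>+y. ennreal (norm (D y)) * indicator ?H y \<partial>lborel) \<le> ennreal (12 / lam k * b k)"
    proof -
      have "(\<integral>\<^sup>+y. ennreal (norm (D y)) * indicator ?H y \<partial>lborel)
        \<le> (\<integral>\<^sup>+y. ennreal (12 / lam k) * (g y * indicator (B k) y) \<partial>lborel)"
      proof (rule nn_integral_mono)
        fix y
        have "ennreal (norm (D y)) \<le> ennreal (12 / lam k) * (ennreal (norm (G y)) * indicator (B k) y)"
          using Dle[of y] lam[of k]
          by (cases "y \<in> B k") (auto simp: ennreal_mult[symmetric] intro!: ennreal_leI)
        then show "ennreal (norm (D y)) * indicator ?H y \<le> ennreal (12 / lam k) * (g y * indicator (B k) y)"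
          by (auto simp: g_def indicator_def)
      qed
      also have "\<dots> = ennreal (12 / lam k) * a k"
        unfolding a_def by (rule nn_integral_cmult) measurable
      also have "\<dots> = ennreal (12 / lam k * b k)"
        unfolding ab using lam[of k] b0[of k] by (intro ennreal_mult[symmetric]) auto
      finally show ?thesis .
    qed
    \<comment> \<open>The weak-type bound needs a finite measure. \<open>E k\<close> lies in the
      support of \<open>f\<close>, and \<open>\<bar>R\<bar> + 1\<close> is a positive radius, as the
      growth condition requires.\<close>
    have fin: "emeasure M (E k) < \<infinity>"
    proof -
      have "E k \<subseteq> {x. dist x 0 \<le> \<bar>R\<bar> + 1}"
      proof
        fix x assume "x \<in> E k"
        then have "f x \<noteq> 0" using lam[of k] by (auto simp: E_def)
        then have "norm x \<le> R" using supp[of x] by (meson not_le)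
        then show "x \<in> {x. dist x 0 \<le> \<bar>R\<bar> + 1}" by simp
      qed
      moreover have "{x. dist x 0 \<le> \<bar>R\<bar> + 1} \<in> sets M" unfolding M by measurable
      ultimately have "emeasure M (E k) \<le> emeasure M {x. dist x 0 \<le> \<bar>R\<bar> + 1}"
        by (rule emeasure_mono)
      also have "\<dots> \<le> ennreal (A * (\<bar>R\<bar> + 1) powr ((real DIM('a) - 1) * q))"
        by (rule growth) simp
      finally show ?thesis by (simp add: le_less_trans)
    qed
    define m where "m = measure M (E k)"
    have m: "emeasure M (E k) = ennreal m" "m \<ge> 0"
      unfolding m_def using fin by (auto simp: emeasure_eq_ennreal_measure)
    have "m powr ((real DIM('a) - 1) / \<beta>) \<le> A powr ((real DIM('a) - 1) / \<beta>) *
        (1 / (\<beta> - real DIM('a) + 1) + 1 / (real DIM('a) - 1)) / measure lborel (half_ball u) * (12 / lam k * b k)"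
    proof (rule weak_type_bound[where f = F and G = D and E = "E k"])
      show "0 \<le> 12 / lam k * b k" using lam[of k] b0[of k] by auto
      show "real DIM('a) - 1 < \<beta>" using \<beta> by (simp add: d_def)
      show "emeasure M {x. dist x y \<le> r} \<le> ennreal (A * r powr \<beta>)" if "0 < r" for y r
        using growth[OF that] by (simp add: \<beta>_def d_def)
    qed (use derF contD suppF u dim M A E F1 m JD in \<open>auto simp: E_def\<close>)
    then have "m powr (1 / q) \<le> K * (12 / lam k * b k)"
      using \<theta> unfolding K by (simp add: d_def \<beta>_def)
    then have "(m powr (1 / q)) powr q \<le> (12 * K * b k / lam k) powr q"
      using q by (intro powr_mono2) (auto simp: ac_simps)
    then have "m \<le> (12 * K * b k / lam k) powr q"
      using q m(2) by (simp add: powr_powr)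
    then show ?thesis unfolding m(1) by (rule ennreal_leI)
  qed
  \<comment> \<open>Here 48 = 4 * 12, with 4 from \<open>\<bar>f x\<bar> \<le> 4 * lam k\<close> on
    the part of \<open>E k\<close> to be covered, and the powers of \<open>lam k\<close> cancel.
    Since \<open>q > 1\<close>, \<open>b k powr q\<close> is at most
    \<open>J powr (q - 1) * b k\<close>, which is linear in \<open>b k\<close> and can be summed
    over the shells.\<close>
  define c where "c = (48 * K) powr q * J powr (q - 1)"
  have c0: "c \<ge> 0" by (simp add: c_def)
  have step: "ennreal ((4 * lam k) powr q) * emeasure M (E k) \<le> ennreal c * a k" for k
  proof -
    have "ennreal ((4 * lam k) powr q) * emeasure M (E k)
        \<le> ennreal ((4 * lam k) powr q) * ennreal ((12 * K * b k / lam k) powr q)"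
      using mE by (rule mult_left_mono) simp
    also have "\<dots> = ennreal ((48 * K * b k) powr q)"
      using lam[of k] K0 b0[of k]
      by (simp add: ennreal_mult[symmetric] powr_mult[symmetric] mult.assoc)
    also have "(48 * K * b k) powr q = (48 * K) powr q * (b k powr (q - 1) * b k)"
    proof -
      have "b k powr q = b k powr (q - 1) * b k"
        using b0[of k] by (cases "b k = 0") (auto simp: powr_diff)
      then show ?thesis using K0 b0[of k] by (simp add: powr_mult)
    qed
    also have "\<dots> \<le> c * b k"
      unfolding c_def mult.assoc using q b0[of k] bJ[of k]
      by (intro mult_left_mono mult_right_mono powr_mono2) auto
    finally show ?thesis
      unfolding ab using c0 b0[of k] by (simp add: ennreal_mult ennreal_leI)
  qed
  have "(\<integral>\<^sup>+x. ennreal (\<bar>f x\<bar> powr q) * indicator ?H x \<partial>M)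
    \<le> (\<integral>\<^sup>+x. (\<integral>\<^sup>+k. ennreal ((4 * lam k) powr q) * indicator (E k) x \<partial>count_space UNIV) \<partial>M)"
  proof (rule nn_integral_mono)
    fix x
    show "ennreal (\<bar>f x\<bar> powr q) * indicator ?H x
      \<le> (\<integral>\<^sup>+k. ennreal ((4 * lam k) powr q) * indicator (E k) x \<partial>count_space UNIV)"
    proof (cases "x \<in> ?H \<and> f x \<noteq> 0")
      case True
      \<comment> \<open>The shift by 1 compensates the factor 2 in \<open>E k\<close>: now
        \<open>\<bar>f x\<bar>\<close> lies between \<open>2 * lam k\<close> and
        \<open>4 * lam k\<close>.\<close>
      define k where "k = \<lfloor>log 2 \<bar>f x\<bar>\<rfloor> - 1"
      have "2 * lam k = 2 powr (real_of_int k + 1)" "4 * lam k = 2 powr (real_of_int k + 2)"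
        by (simp_all add: lam_powr powr_add)
      moreover have "2 powr (real_of_int k + 1) \<le> \<bar>f x\<bar>"
        using True by (subst le_log_iff[symmetric]) (auto simp: k_def)
      moreover have "\<bar>f x\<bar> \<le> 2 powr (real_of_int k + 2)"
        using True unfolding k_def by (subst log_le_iff[symmetric]) (auto, linarith)
      ultimately have "x \<in> E k" "\<bar>f x\<bar> \<le> 4 * lam k" using True by (auto simp: E_def)
      then have "ennreal (\<bar>f x\<bar> powr q) * indicator ?H x \<le> ennreal ((4 * lam k) powr q) * indicator (E k) x"
        using True q by (auto intro!: ennreal_leI powr_mono2)
      also have "\<dots> \<le> (\<integral>\<^sup>+k. ennreal ((4 * lam k) powr q) * indicator (E k) x \<partial>count_space UNIV)"
        by (rule nn_integral_ge_point) simp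
      finally show ?thesis .
    qed auto
  qed
  also have "\<dots> = (\<integral>\<^sup>+k. (\<integral>\<^sup>+x. ennreal ((4 * lam k) powr q) * indicator (E k) x \<partial>M) \<partial>count_space UNIV)"
    by (rule nn_integral_count_space_nn_integral) auto
  also have "\<dots> = (\<integral>\<^sup>+k. ennreal ((4 * lam k) powr q) * emeasure M (E k) \<partial>count_space UNIV)"
    by (intro nn_integral_cong nn_integral_cmult_indicator) (simp add: M)
  also have "\<dots> \<le> (\<integral>\<^sup>+k. ennreal c * a k \<partial>count_space UNIV)"
    by (intro nn_integral_mono step)
  also have "\<dots> = ennreal c * (\<integral>\<^sup>+k. a k \<partial>count_space UNIV)"
    by (rule nn_integral_cmult) simp
  also have "(\<integral>\<^sup>+k. a k \<partial>count_space UNIV) = (\<integral>\<^sup>+y. (\<integral>\<^sup>+k. g y * indicator (B k) y \<partial>count_space UNIV) \<partial>lborel)"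
    unfolding a_def by (rule nn_integral_count_space_nn_integral[symmetric]) auto
  also have "\<dots> \<le> (\<integral>\<^sup>+y. g y \<partial>lborel)"
  proof (rule nn_integral_mono)
    fix y
    have "k = k'" if "y \<in> B k" "y \<in> B k'" for k k'
    proof -
      have less: "j \<le> i" if "y \<in> B i" "y \<in> B j" for i j
      proof -
        have "lam j < 2 * lam i" using that by (auto simp: B_def)
        also have "\<dots> = lam (i + 1)" by (simp add: lam_def power_int_add)
        finally have "j < i + 1" by (simp add: lam_powr)
        then show ?thesis by simp
      qed
      show ?thesis using less[OF that] less[OF that(2,1)] by simp
    qed
    then obtain k0 where k0: "{k. y \<in> B k} \<subseteq> {k0}" by blast
    have "(\<integral>\<^sup>+k. g y * indicator (B k) y \<partial>count_space UNIV) \<le> (\<integral>\<^sup>+k. g y * indicator {k0} k \<partial>count_space UNIV)"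
      using k0 by (intro nn_integral_mono) (auto simp: indicator_def)
    also have "\<dots> = g y * emeasure (count_space UNIV) {k0}"
      by (rule nn_integral_cmult_indicator) simp
    finally show "(\<integral>\<^sup>+k. g y * indicator (B k) y \<partial>count_space UNIV) \<le> g y" by simp
  qed
  also have "\<dots> \<le> ennreal J" using J(1) unfolding g_def .
  finally have "(\<integral>\<^sup>+x. ennreal (\<bar>f x\<bar> powr q) * indicator ?H x \<partial>M) \<le> ennreal c * ennreal J"
    by (simp add: mult_left_mono)
  also have "\<dots> = ennreal (c * J)" using c0 J(2) by (simp add: ennreal_mult)
  also have "c * J = (48 * K * J) powr q"
  proof -
    have "J powr q = J powr (q - 1) * J"
      using J(2) by (cases "J = 0") (auto simp: powr_diff)
    then show ?thesis using K0 J(2) by (simp add: c_def powr_mult)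
  qed
  finally show ?thesis .
qed

section \<open>Ball growth for a power of a coordinate, and the unweighted inequality\<close>

text \<open>Where \<open>\<bar>s\<bar> \<le> r\<close> the interval is enlarged to the whole of
  \<open>{-r..r}\<close>, giving \<open>2 / (p + 1)\<close>; elsewhere \<open>p \<le> 0\<close>
  bounds the power by \<open>r powr p\<close> on a set of length at most \<open>2 * r\<close>. This
  makes the estimate independent of the centre \<open>c\<close>.\<close>

lemma nn_integral_abs_powr_interval_le:
  fixes p r c :: real
  assumes p: "-1 < p" "p \<le> 0" and r: "0 < r"
  shows "(\<integral>\<^sup>+s. ennreal (\<bar>s\<bar> powr p) * indicator {s. \<bar>s - c\<bar> \<le> r} s \<partial>lborel)
    \<le> ennreal ((2 / (p + 1) + 2) * r powr (p + 1))"
proof -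
  have I: "((\<lambda>s. s powr p) has_integral r powr (p + 1) / (p + 1)) {0..r}"
    using p r by (intro has_integral_powr_from_0) auto
  have I1: "(\<integral>\<^sup>+s. ennreal (s powr p) * indicator {0..r} s \<partial>lborel) = ennreal (r powr (p + 1) / (p + 1))"
    by (rule nn_integral_has_integral_lebesgue'[OF _ I]) simp
  have "(\<integral>\<^sup>+s. ennreal (s powr p) * indicator {0..r} s \<partial>lborel)
      = (\<integral>\<^sup>+s. ennreal ((-s) powr p) * indicator {0..r} (-s) \<partial>lborel)"
    using nn_integral_real_affine[of "\<lambda>s. ennreal (s powr p) * indicator {0..r} s" "-1" 0] by simp
  then have I2: "(\<integral>\<^sup>+s. ennreal ((-s) powr p) * indicator {0..r} (-s) \<partial>lborel) = ennreal (r powr (p + 1) / (p + 1))"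
    using I1 by simp
  have "(\<integral>\<^sup>+s. ennreal (\<bar>s\<bar> powr p) * indicator {s. \<bar>s - c\<bar> \<le> r} s \<partial>lborel)
    \<le> (\<integral>\<^sup>+s. (ennreal (s powr p) * indicator {0..r} s + ennreal ((-s) powr p) * indicator {0..r} (-s))
          + ennreal (r powr p) * indicator {s. \<bar>s - c\<bar> \<le> r} s \<partial>lborel)"
  proof (rule nn_integral_mono)
    fix s :: real
    have "\<bar>s\<bar> powr p \<le> r powr p" if "\<not> \<bar>s\<bar> \<le> r"
      using that p r by (intro powr_mono2') auto
    then show "ennreal (\<bar>s\<bar> powr p) * indicator {s. \<bar>s - c\<bar> \<le> r} s
      \<le> (ennreal (s powr p) * indicator {0..r} s + ennreal ((-s) powr p) * indicator {0..r} (-s))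
          + ennreal (r powr p) * indicator {s. \<bar>s - c\<bar> \<le> r} s"
      by (cases "\<bar>s\<bar> \<le> r"; cases "s \<ge> 0")
        (auto simp: indicator_def ennreal_plus[symmetric] simp del: ennreal_plus intro!: ennreal_leI add_increasing2)
  qed
  also have "\<dots> = ennreal (r powr (p + 1) / (p + 1)) + ennreal (r powr (p + 1) / (p + 1)) + ennreal (r powr p) * ennreal (2 * r)"
  proof -
    have "{s. \<bar>s - c\<bar> \<le> r} = {c - r..c + r}" by auto
    then show ?thesis using r by (simp add: nn_integral_add I1 I2 nn_integral_cmult_indicator)
  qed
  also have "\<dots> = ennreal ((2 / (p + 1) + 2) * r powr (p + 1))"
    using p r by (simp add: ennreal_plus[symmetric] ennreal_mult[symmetric] powr_add algebra_simps add_divide_distrib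
      del: ennreal_plus)
  finally show ?thesis .
qed

text \<open>The ball lies in the cube of side \<open>2 * r\<close> about \<open>y\<close>, over
  which the integral factorises. Direction \<open>i\<close> contributes
  \<open>r powr (p + 1)\<close> up to a constant, every other direction
  \<open>2 * r\<close>.\<close>

lemma emeasure_coordinate_power_le:
  fixes i y :: "'a::euclidean_space"
  assumes i: "i \<in> Basis" and p: "-1 < p" "p \<le> 0" and r: "0 < r"
  shows "emeasure (density lborel (\<lambda>x. ennreal (\<bar>x \<bullet> i\<bar> powr p))) {x. dist x y \<le> r}
    \<le> ennreal (2 ^ (DIM('a) - 1) * (2 / (p + 1) + 2) * r powr (real DIM('a) + p))"
proof -
  define h where "h b s = ennreal ((if b = i then \<bar>s\<bar> powr p else 1)) * indicator {s. \<bar>s - y \<bullet> b\<bar> \<le> r} s"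
    for b :: 'a and s :: real
  have h[measurable]: "h b \<in> borel_measurable borel" for b unfolding h_def by measurable
  have hi: "(\<integral>\<^sup>+s. h i s \<partial>lborel) \<le> ennreal ((2 / (p + 1) + 2) * r powr (p + 1))"
    unfolding h_def using nn_integral_abs_powr_interval_le[OF p r] by simp
  have hb: "(\<integral>\<^sup>+s. h b s \<partial>lborel) = ennreal (2 * r)" if "b \<noteq> i" for b
  proof -
    have "(\<integral>\<^sup>+s. h b s \<partial>lborel) = (\<integral>\<^sup>+s. indicator {y \<bullet> b - r..y \<bullet> b + r} s \<partial>lborel)"
      using that unfolding h_def by (intro nn_integral_cong) (auto simp: indicator_def)
    then show ?thesis using r by simp
  qed
  have "emeasure (density lborel (\<lambda>x. ennreal (\<bar>x \<bullet> i\<bar> powr p))) {x. dist x y \<le> r}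
      = (\<integral>\<^sup>+x. ennreal (\<bar>x \<bullet> i\<bar> powr p) * indicator {x. dist x y \<le> r} x \<partial>lborel)"
    by (rule emeasure_density) measurable
  also have "\<dots> \<le> (\<integral>\<^sup>+x. (\<Prod>b\<in>Basis. h b (x \<bullet> b)) \<partial>lborel)"
  proof (rule nn_integral_mono)
    fix x :: 'a
    show "ennreal (\<bar>x \<bullet> i\<bar> powr p) * indicator {x. dist x y \<le> r} x \<le> (\<Prod>b\<in>Basis. h b (x \<bullet> b))"
    proof (cases "dist x y \<le> r")
      case True
      have "\<bar>x \<bullet> b - y \<bullet> b\<bar> \<le> r" if "b \<in> Basis" for b
        using True Basis_le_norm[OF that, of "x - y"] by (simp add: dist_norm inner_diff_left)
      then have "h b (x \<bullet> b) = (if b = i then ennreal (\<bar>x \<bullet> i\<bar> powr p) else 1)" if "b \<in> Basis" for b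
        using that by (simp add: h_def)
      then have "(\<Prod>b\<in>Basis. h b (x \<bullet> b)) = (\<Prod>b\<in>Basis. if b = i then ennreal (\<bar>x \<bullet> i\<bar> powr p) else 1)"
        by (rule prod.cong[OF refl])
      also have "\<dots> = ennreal (\<bar>x \<bullet> i\<bar> powr p)" using i by (simp add: prod.delta)
      finally show ?thesis by (simp add: indicator_def)
    qed simp
  qed
  also have "\<dots> = (\<Prod>b\<in>Basis. (\<integral>\<^sup>+s. h b s \<partial>lborel))"
    by (rule nn_integral_lborel_prod) auto
  also have "\<dots> = (\<integral>\<^sup>+s. h i s \<partial>lborel) * (\<Prod>b\<in>Basis - {i}. (\<integral>\<^sup>+s. h b s \<partial>lborel))"
    using i by (simp add: prod.remove)
  also have "(\<Prod>b\<in>Basis - {i}. (\<integral>\<^sup>+s. h b s \<partial>lborel)) = ennreal ((2 * r) ^ (DIM('a) - 1))"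
    using i r by (simp add: hb ennreal_power)
  also have "(\<integral>\<^sup>+s. h i s \<partial>lborel) * \<dots> \<le> ennreal ((2 / (p + 1) + 2) * r powr (p + 1)) * \<dots>"
    using hi by (rule mult_right_mono) simp
  also have "\<dots> = ennreal ((2 / (p + 1) + 2) * r powr (p + 1) * (2 * r) ^ (DIM('a) - 1))"
    using p r by (intro ennreal_mult[symmetric]) auto
  also have "(2 / (p + 1) + 2) * r powr (p + 1) * (2 * r) ^ (DIM('a) - 1)
      = 2 ^ (DIM('a) - 1) * (2 / (p + 1) + 2) * r powr (real DIM('a) + p)"
  proof -
    have "r ^ (DIM('a) - 1) = r powr (real DIM('a) - 1)"
      using r by (simp add: powr_realpow[symmetric] of_nat_diff Suc_leI)
    then have "r powr (p + 1) * r ^ (DIM('a) - 1) = r powr (real DIM('a) + p)"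
      by (simp add: powr_add[symmetric] add.commute)
    then show ?thesis by (simp add: power_mult_distrib mult_ac)
  qed
  finally show ?thesis .
qed

text \<open>For \<open>p = (d - 1) * q - d\<close>, where \<open>d = DIM('a)\<close>, the growth
  exponent \<open>d + p\<close> is the \<open>(d - 1) * q\<close> that the strong-type bound asks
  for. The constant is chosen before \<open>\<epsilon>\<close> and \<open>R\<close>; this uniformity
  is what later allows \<open>\<epsilon>\<close> to tend to 0.\<close>

lemma half_space_sobolev:
  fixes i u :: "'a::euclidean_space" and q :: real
  assumes i: "i \<in> Basis" and u: "u \<noteq> 0" and dim: "DIM('a) \<ge> 2"
    and q: "1 < q" "q \<le> real DIM('a) / (real DIM('a) - 1)"
  shows "\<exists>C>0. \<forall>f G \<epsilon> R J.
    (\<forall>y. \<epsilon> < y \<bullet> u \<longrightarrow> (f has_derivative (\<lambda>h. G y \<bullet> h)) (at y)) \<and>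
    continuous_on {y. \<epsilon> < y \<bullet> u} G \<and> (\<forall>y. R < norm y \<longrightarrow> f y = 0) \<and> f \<in> borel_measurable borel \<and>
    (\<integral>\<^sup>+y. ennreal (norm (G y)) * indicator {y. \<epsilon> < y \<bullet> u} y \<partial>lborel) \<le> ennreal J \<and> 0 \<le> J \<longrightarrow>
    (\<integral>\<^sup>+x. ennreal (\<bar>x \<bullet> i\<bar> powr ((real DIM('a) - 1) * q - real DIM('a)) * \<bar>f x\<bar> powr q)
        * indicator {y. \<epsilon> < y \<bullet> u} x \<partial>lborel) \<le> ennreal ((C * J) powr q)"
proof -
  define d where "d = real DIM('a)"
  have d: "d > 1" using dim by (simp add: d_def)
  define p where "p = (d - 1) * q - d"
  have "d - 1 < (d - 1) * q" using d q by simp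
  then have p1: "-1 < p" by (simp add: p_def)
  have p0: "p \<le> 0" using q(2) d by (simp add: p_def d_def field_simps)
  define M where "M = density lborel (\<lambda>x::'a. ennreal (\<bar>x \<bullet> i\<bar> powr p))"
  have M: "sets M = sets borel" by (simp add: M_def)
  have sf: "sigma_finite_measure M"
    unfolding M_def by (subst sigma_finite_measure.sigma_finite_iff_density_finite[OF sigma_finite_lborel]) auto
  define A where "A = 2 ^ (DIM('a) - 1) * (2 / (p + 1) + 2)"
  have A: "A > 0" unfolding A_def using p1 by (intro mult_pos_pos add_nonneg_pos) auto
  have growth: "emeasure M {x. dist x y \<le> r} \<le> ennreal (A * r powr ((real DIM('a) - 1) * q))"
    if "0 < r" for y r
    using emeasure_coordinate_power_le[OF i p1 p0 that, of y] unfolding M_def A_def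
    by (simp add: p_def d_def)
  define K where "K = A powr (1 / q) * (1 / ((real DIM('a) - 1) * q - real DIM('a) + 1) + 1 / (real DIM('a) - 1))
      / measure lborel (half_ball u)"
  show ?thesis
  \<comment> \<open>Only \<open>K \<ge> 0\<close> is derived, so the maximum supplies
    positivity.\<close>
  proof (intro exI[of _ "max 1 (48 * K)"] conjI allI impI)
    fix f :: "'a \<Rightarrow> real" and G \<epsilon> R J
    assume H: "(\<forall>y. \<epsilon> < y \<bullet> u \<longrightarrow> (f has_derivative (\<lambda>h. G y \<bullet> h)) (at y)) \<and>
      continuous_on {y. \<epsilon> < y \<bullet> u} G \<and> (\<forall>y. R < norm y \<longrightarrow> f y = 0) \<and> f \<in> borel_measurable borel \<and>
      (\<integral>\<^sup>+y. ennreal (norm (G y)) * indicator {y. \<epsilon> < y \<bullet> u} y \<partial>lborel) \<le> ennreal J \<and> 0 \<le> J"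
    then have f[measurable]: "f \<in> borel_measurable borel" by blast
    have "(\<integral>\<^sup>+x. ennreal (\<bar>x \<bullet> i\<bar> powr ((real DIM('a) - 1) * q - real DIM('a)) * \<bar>f x\<bar> powr q)
        * indicator {y. \<epsilon> < y \<bullet> u} x \<partial>lborel)
      = (\<integral>\<^sup>+x. ennreal (\<bar>f x\<bar> powr q) * indicator {y. \<epsilon> < y \<bullet> u} x \<partial>M)"
      unfolding M_def
      by (subst nn_integral_density) (auto simp: p_def d_def ennreal_mult mult.assoc)
    also have "\<dots> \<le> ennreal ((48 * K * J) powr q)"
      by (rule strong_type_bound[where G = G and R = R])
        (use H u dim M sf q growth A K_def in auto)
    also have "\<dots> \<le> ennreal ((max 1 (48 * K) * J) powr q)"
    proof -
      have "0 \<le> 1 / ((d - 1) * q - d + 1) + 1 / (d - 1)"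
        by (rule add_nonneg_nonneg; rule divide_nonneg_pos) (use p1 d in \<open>simp_all add: p_def\<close>)
      then have "K \<ge> 0" unfolding K_def d_def[symmetric]
        using measure_nonneg powr_ge_zero by (intro divide_nonneg_nonneg mult_nonneg_nonneg)
      then show ?thesis using q H
        by (intro ennreal_leI powr_mono2 mult_right_mono) auto
    qed
    finally show "(\<integral>\<^sup>+x. ennreal (\<bar>x \<bullet> i\<bar> powr ((real DIM('a) - 1) * q - real DIM('a)) * \<bar>f x\<bar> powr q)
        * indicator {y. \<epsilon> < y \<bullet> u} x \<partial>lborel) \<le> ennreal ((max 1 (48 * K) * J) powr q)" .
  qed simp
qed

section \<open>The Hardy inequality\<close>

text \<open>Steps \<open>1 / Suc m\<close> give a sequence, as dominated convergence requires, and
  turn the division by the step into a multiplication by \<open>Suc m\<close>.\<close>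

lemma difference_quotient_LIMSEQ:
  fixes f :: "'a::real_normed_vector \<Rightarrow> real"
  assumes "(f has_derivative D) (at x)"
  shows "(\<lambda>m. (f (x + (1 / real (Suc m)) *\<^sub>R v) - f x) * real (Suc m)) \<longlonglongrightarrow> D v"
proof -
  interpret D: bounded_linear D using assms by (rule has_derivative_bounded_linear)
  have 1: "((\<lambda>s. x + s *\<^sub>R v) has_derivative (\<lambda>s. s *\<^sub>R v)) (at 0)"
    by (auto intro!: derivative_eq_intros)
  have 2: "(f has_derivative D) (at (x + 0 *\<^sub>R v))" using assms by simp
  have "((\<lambda>s. f (x + s *\<^sub>R v)) has_real_derivative D v) (at 0)"
    using has_derivative_compose[OF 1 2]
    by (simp add: has_field_derivative_def D.scaleR mult_commute_abs)
  then have "((\<lambda>s. (f (x + s *\<^sub>R v) - f x) / s) \<longlongrightarrow> D v) (at 0)"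
    by (simp add: DERIV_def)
  moreover have "filterlim (\<lambda>m. 1 / real (Suc m)) (at 0) sequentially"
    by (intro filterlim_atI lim_1_over_n[THEN LIMSEQ_Suc]) auto
  ultimately have "(\<lambda>m. (f (x + (1 / real (Suc m)) *\<^sub>R v) - f x) / (1 / real (Suc m))) \<longlonglongrightarrow> D v"
    by (rule filterlim_compose)
  then show ?thesis by simp
qed

lemma inner_sum_Basis_subset:
  assumes S: "S \<subseteq> Basis" and b: "b \<in> Basis"
  shows "(\<Sum>j\<in>S. (x \<bullet> j) *\<^sub>R j) \<bullet> b = (if b \<in> S then x \<bullet> b else 0)"
proof -
  have "(\<Sum>j\<in>S. (x \<bullet> j) *\<^sub>R j) \<bullet> b = (\<Sum>j\<in>S. if j = b then x \<bullet> b else 0)"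
    using S b by (auto simp: inner_sum_left inner_Basis intro!: sum.cong)
  then show ?thesis using rev_finite_subset[OF finite_Basis S] by (simp add: sum.delta)
qed

text \<open>The map multiplies the coordinates in \<open>S\<close> by \<open>t\<close> and fixes the
  others, hence the Jacobian \<open>t ^ card S\<close>. It is written as a displacement so that
  \<open>t = 1 + h\<close> yields difference quotients along the projection of
  \<open>x\<close>.\<close>

lemma nn_integral_dilation:
  fixes g :: "'a::euclidean_space \<Rightarrow> ennreal"
  assumes S: "S \<subseteq> Basis" and t: "0 < t" and [measurable]: "g \<in> borel_measurable borel"
  shows "ennreal (t ^ card S) * (\<integral>\<^sup>+x. g (x + (t - 1) *\<^sub>R (\<Sum>j\<in>S. (x \<bullet> j) *\<^sub>R j)) \<partial>lborel) = (\<integral>\<^sup>+x. g x \<partial>lborel)"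
proof -
  define c where "c j = (if j \<in> S then t else 1)" for j :: 'a
  have c: "c j \<noteq> 0" for j using t by (simp add: c_def)
  have prod: "(\<Prod>j\<in>Basis. \<bar>c j\<bar>) = t ^ card S"
  proof -
    have "(\<Prod>j\<in>Basis. \<bar>c j\<bar>) = (\<Prod>j\<in>Basis. if j \<in> S then t else 1)"
      using t by (intro prod.cong) (auto simp: c_def)
    also have "\<dots> = (\<Prod>j\<in>S. t)"
    proof -
      have "{j \<in> Basis. j \<in> S} = S" using S by blast
      then show ?thesis by (subst prod.inter_filter[symmetric]) simp_all
    qed
    finally show ?thesis by simp
  qed
  have map: "(\<Sum>j\<in>Basis. (c j * (x \<bullet> j)) *\<^sub>R j) = x + (t - 1) *\<^sub>R (\<Sum>j\<in>S. (x \<bullet> j) *\<^sub>R j)" for x :: 'a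
  proof (rule euclidean_eqI)
    fix b :: 'a assume b: "b \<in> Basis"
    have "(\<Sum>j\<in>S. (x \<bullet> j) *\<^sub>R j) \<bullet> b = (if b \<in> S then x \<bullet> b else 0)"
      using S b by (rule inner_sum_Basis_subset)
    then show "(\<Sum>j\<in>Basis. (c j * (x \<bullet> j)) *\<^sub>R j) \<bullet> b = (x + (t - 1) *\<^sub>R (\<Sum>j\<in>S. (x \<bullet> j) *\<^sub>R j)) \<bullet> b"
      using b by (simp add: inner_add_left c_def algebra_simps)
  qed
  have "(\<integral>\<^sup>+x. g x \<partial>lborel) = (\<integral>\<^sup>+x. g x
      \<partial>density (distr lborel borel (\<lambda>x. 0 + (\<Sum>j\<in>Basis. (c j * (x \<bullet> j)) *\<^sub>R j))) (\<lambda>_. ennreal (\<Prod>j\<in>Basis. \<bar>c j\<bar>)))"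
    using lborel_affine_euclidean[of c 0] c by simp
  also have "\<dots> = ennreal (t ^ card S) * (\<integral>\<^sup>+x. g (\<Sum>j\<in>Basis. (c j * (x \<bullet> j)) *\<^sub>R j) \<partial>lborel)"
    unfolding prod using t by (simp add: nn_integral_density nn_integral_distr nn_integral_cmult)
  finally show ?thesis unfolding map by simp
qed

lemma compact_image_bounded:
  fixes f :: "'a::topological_space \<Rightarrow> 'b::real_normed_vector"
  assumes "compact K" "continuous_on K f"
  shows "\<exists>B\<ge>0. \<forall>x\<in>K. norm (f x) \<le> B"
proof -
  have "bounded (f ` K)"
    using assms compact_continuous_image compact_imp_bounded by blast
  then obtain B where "\<forall>x\<in>K. norm (f x) \<le> B" by (auto simp: bounded_iff)
  then have "\<forall>x\<in>K. norm (f x) \<le> \<bar>B\<bar>" using abs_ge_self order_trans by blast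
  then show ?thesis using abs_ge_zero by blast
qed

lemma integrable_if_bounded_support:
  fixes F :: "'a::euclidean_space \<Rightarrow> real"
  assumes "F \<in> borel_measurable borel" "\<And>x. norm x \<le> R \<Longrightarrow> \<bar>F x\<bar> \<le> B" "\<And>x. R < norm x \<Longrightarrow> F x = 0"
  shows "integrable lborel F"
proof (rule integrableI_bounded_set[of "cball 0 R" _ _ B])
  show "emeasure lborel (cball 0 R :: 'a set) < \<infinity>"
    using emeasure_bounded_finite[OF bounded_cball] .
qed (use assms in \<open>auto simp: not_le[symmetric]\<close>)

text \<open>Instead of integrating \<open>div (U \<bar>w\<bar> P)\<close> over the half-space, compare the integral of \<open>U \<bar>w\<bar>\<close> over
  the half-space and its image under the dilation \<open>x \<mapsto> x + h P x\<close>, which is contained in the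
  half-space, and let \<open>h \<rightarrow> 0\<close>. The boundary term has a good sign and \<open>\<bar>w\<bar>\<close> need not be smoothed.\<close>

lemma half_space_dilation_inequality:
  fixes U w :: "'a::euclidean_space \<Rightarrow> real" and gU gw :: "'a \<Rightarrow> 'a" and S :: "'a set"
  defines "P \<equiv> \<lambda>x. \<Sum>j\<in>S. (x \<bullet> j) *\<^sub>R j"
  assumes S: "S \<subseteq> Basis" and Pu: "\<And>x. P x \<bullet> u = x \<bullet> u" and \<epsilon>: "0 < \<epsilon>" and R: "0 < R"
    and U: "\<And>x. 0 < x \<bullet> u \<Longrightarrow> (U has_derivative (\<lambda>h. gU x \<bullet> h)) (at x)"
    and gU: "continuous_on {x. 0 < x \<bullet> u} gU"
    and U0: "\<And>x. 0 \<le> U x" and Um[measurable]: "U \<in> borel_measurable borel"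
    and w: "\<And>x. (w has_derivative (\<lambda>h. gw x \<bullet> h)) (at x)"
    and gw: "continuous_on UNIV gw" and supp: "\<And>x. R < norm x \<Longrightarrow> w x = 0"
  shows "(\<integral>x. indicator {x. \<epsilon> < x \<bullet> u} x *
      ((real (card S) * U x + gU x \<bullet> P x) * \<bar>w x\<bar> - U x * \<bar>gw x \<bullet> P x\<bar>) \<partial>lborel) \<le> 0"
proof -
  let ?H = "{x. \<epsilon> < x \<bullet> u}"
  have Pb: "P x \<bullet> b = (if b \<in> S then x \<bullet> b else 0)" if b: "b \<in> Basis" for x b
    unfolding P_def using S b by (rule inner_sum_Basis_subset)
  have Pnorm: "norm (P x) \<le> norm x" for x
    by (rule norm_le_componentwise) (simp add: Pb)
  have contP: "continuous_on A P" for A unfolding P_def by (intro continuous_intros)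
  have [measurable]: "P \<in> borel_measurable borel"
    using contP by (rule borel_measurable_continuous_onI)
  have contw: "continuous_on A w" for A
    using w by (auto intro!: continuous_at_imp_continuous_on has_derivative_continuous)
  then have [measurable]: "w \<in> borel_measurable borel"
    by (rule borel_measurable_continuous_onI)
  have [measurable]: "?H \<in> sets borel" by measurable
  define h where "h m = 1 / real (Suc m)" for m
  have h: "0 < h m" "h m \<le> 1" for m by (auto simp: h_def)
  have hS: "h m * real (Suc m) = 1" for m by (simp add: h_def)
  define \<phi> where "\<phi> m x = x + h m *\<^sub>R P x" for m x
  have [measurable]: "\<phi> m \<in> borel_measurable borel" for m unfolding \<phi>_def by measurable
  have \<phi>H: "x \<bullet> u \<le> \<phi> m x \<bullet> u" if "0 \<le> x \<bullet> u" for x m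
    using that h[of m] by (simp add: \<phi>_def inner_add_left Pu)
  have \<phi>_le: "norm (\<phi> m x) \<le> 2 * norm x" for m x
  proof -
    have "norm (h m *\<^sub>R P x) \<le> 1 * norm x"
      unfolding norm_scaleR using h[of m] Pnorm by (intro mult_mono) auto
    then show ?thesis unfolding \<phi>_def using norm_triangle_ineq[of x "h m *\<^sub>R P x"] by simp
  qed
  \<comment> \<open>Since the dilation does not decrease the norm, beyond radius \<open>R\<close>
    both \<open>w x\<close> and \<open>w (\<phi> m x)\<close> vanish, and the dominating function
    can be supported in \<open>cball 0 R\<close>.\<close>
  have \<phi>_ge: "norm x \<le> norm (\<phi> m x)" for m x
  proof (rule norm_le_componentwise)
    fix b :: 'a assume b: "b \<in> Basis"
    have "\<bar>x \<bullet> b\<bar> \<le> (1 + h m) * \<bar>x \<bullet> b\<bar>" using h[of m] by (simp add: algebra_simps)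
    also have "\<dots> = \<bar>(1 + h m) * (x \<bullet> b)\<bar>" using h[of m] by (simp add: abs_mult)
    finally show "\<bar>x \<bullet> b\<bar> \<le> \<bar>\<phi> m x \<bullet> b\<bar>"
      using b by (auto simp: \<phi>_def inner_add_left Pb algebra_simps)
  qed
  define l where "l = card S"
  define T where "T m = (1 + h m) ^ l" for m
  have T: "1 \<le> T m" "T m \<le> 2 ^ l" for m
    unfolding T_def using h[of m] by (auto intro!: one_le_power power_mono)
  \<comment> \<open>The derivative of the Jacobian at the identity is the divergence of
    \<open>P\<close>, namely \<open>card S\<close>.\<close>
  have limT: "(\<lambda>m. (T m - 1) * real (Suc m)) \<longlonglongrightarrow> real l"
  proof -
    have "((\<lambda>t::real. t ^ l) has_derivative (\<lambda>v. real l * v)) (at 1)"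
      by (auto intro!: derivative_eq_intros)
    from difference_quotient_LIMSEQ[OF this, of 1] show ?thesis by (simp add: T_def h_def)
  qed
  then have "Bseq (\<lambda>m. (T m - 1) * real (Suc m))"
    by (intro convergent_imp_Bseq convergentI)
  then obtain L where L: "\<And>m. \<bar>(T m - 1) * real (Suc m)\<bar> \<le> L"
    unfolding Bseq_def real_norm_def by blast
  have limh: "h \<longlonglongrightarrow> 0" unfolding h_def by (rule lim_1_over_n[THEN LIMSEQ_Suc])
  have limT1: "T \<longlonglongrightarrow> 1"
    unfolding T_def using tendsto_power[OF tendsto_add[OF tendsto_const limh], of 1 l] by simp
  \<comment> \<open>Radius \<open>2 * R\<close> contains the images of points of norm at most
    \<open>R\<close>; the set stays away from the hyperplane, where \<open>U\<close> may be
    singular, and its convexity is needed for the mean value inequality.\<close>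
  define K where "K = cball 0 (2 * R) \<inter> {x. \<epsilon> \<le> x \<bullet> u}"
  have K: "compact K" "convex K" unfolding K_def
    by (auto intro!: compact_Int_closed closed_Collect_le continuous_intros convex_Int convex_halfspace_ge
        simp: inner_commute[of _ u])
  have KH: "K \<subseteq> {x. 0 < x \<bullet> u}" using \<epsilon> by (auto simp: K_def)
  have contU: "continuous_on {x. 0 < x \<bullet> u} U"
    using U by (auto intro!: continuous_at_imp_continuous_on has_derivative_continuous)
  obtain BU where BU: "\<And>x. x \<in> K \<Longrightarrow> U x \<le> BU" "BU \<ge> 0"
    using compact_image_bounded[OF K(1) continuous_on_subset[OF contU KH]]
    by (metis abs_le_D1 real_norm_def)
  obtain BG where BG: "\<And>x. x \<in> K \<Longrightarrow> norm (gU x) \<le> BG" "BG \<ge> 0"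
    using compact_image_bounded[OF K(1) continuous_on_subset[OF gU KH]] by blast
  obtain Bw where Bw: "\<And>x. x \<in> cball 0 (2 * R) \<Longrightarrow> norm (gw x) \<le> Bw" "Bw \<ge> 0"
    using compact_image_bounded[OF compact_cball continuous_on_subset[OF gw subset_UNIV]] by blast
  obtain B0 where B0: "\<And>x. x \<in> cball 0 (2 * R) \<Longrightarrow> \<bar>w x\<bar> \<le> B0" "B0 \<ge> 0"
    using compact_image_bounded[OF compact_cball contw] by (metis real_norm_def)
  have inK: "x \<in> K" "\<phi> m x \<in> K" if "x \<in> ?H" "norm x \<le> R" for x m
    using that \<phi>H[of x m] \<phi>_le[of m x] \<epsilon> R by (auto simp: K_def)
  have dphi: "norm (\<phi> m x - x) \<le> h m * R" if "norm x \<le> R" for m x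
    using that Pnorm[of x] h[of m] by (simp add: \<phi>_def mult_left_mono)
  have dU: "\<bar>U (\<phi> m x) - U x\<bar> * real (Suc m) \<le> BG * R" if "x \<in> ?H" "norm x \<le> R" for m x
  proof -
    have "norm (U (\<phi> m x) - U x) \<le> BG * norm (\<phi> m x - x)"
    proof (rule differentiable_bound[OF K(2)])
      show "(U has_derivative (\<lambda>h. gU y \<bullet> h)) (at y within K)" if "y \<in> K" for y
        using U KH that by (blast intro: has_derivative_at_withinI)
      show "onorm (\<lambda>h. gU y \<bullet> h) \<le> BG" if "y \<in> K" for y
        using BG(1)[OF that] BG(2) order_trans[OF Cauchy_Schwarz_ineq2]
        by (intro onorm_bound) (auto intro!: mult_right_mono order_trans[OF Cauchy_Schwarz_ineq2])
    qed (use inK that in auto)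
    also have "\<dots> \<le> BG * (h m * R)" using dphi[OF that(2)] BG(2) by (rule mult_left_mono)
    finally have "\<bar>U (\<phi> m x) - U x\<bar> * real (Suc m) \<le> BG * (h m * R) * real (Suc m)"
      by (intro mult_right_mono) auto
    also have "\<dots> = BG * R * (h m * real (Suc m))" by simp
    finally show ?thesis unfolding hS by simp
  qed
  have dw: "\<bar>w (\<phi> m x) - w x\<bar> * real (Suc m) \<le> Bw * R" if "norm x \<le> R" for m x
  proof -
    have "norm (w (\<phi> m x) - w x) \<le> Bw * norm (\<phi> m x - x)"
    proof (rule differentiable_bound[OF convex_cball[of 0 "2 * R"]])
      show "(w has_derivative (\<lambda>h. gw y \<bullet> h)) (at y within cball 0 (2 * R))" for y
        using w by (blast intro: has_derivative_at_withinI)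
      show "onorm (\<lambda>h. gw y \<bullet> h) \<le> Bw" if "y \<in> cball 0 (2 * R)" for y
        using Bw(1)[OF that] Bw(2)
        by (intro onorm_bound) (auto intro!: mult_right_mono order_trans[OF Cauchy_Schwarz_ineq2])
    qed (use that \<phi>_le[of m x] R in auto)
    also have "\<dots> \<le> Bw * (h m * R)" using dphi[OF that] Bw(2) by (rule mult_left_mono)
    finally have "\<bar>w (\<phi> m x) - w x\<bar> * real (Suc m) \<le> Bw * (h m * R) * real (Suc m)"
      by (intro mult_right_mono) auto
    also have "\<dots> = Bw * R * (h m * real (Suc m))" by simp
    finally show ?thesis unfolding hS by simp
  qed
  \<comment> \<open>A lower bound for the difference quotient of \<open>U \<bar>w\<bar>\<close>,
    obtained from \<open>\<bar>w (\<phi> m x)\<bar> \<ge> \<bar>w x\<bar> - \<bar>w (\<phi> m x) - w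
    x\<bar>\<close>. Unlike the quotient of \<open>\<bar>w\<bar>\<close>, its terms are controlled
    by the derivative of \<open>w\<close> itself, so the limit is explicit also at zeros of
    \<open>w\<close>.\<close>
  define F where "F m x = indicator ?H x * (((T m * U (\<phi> m x) - U x) * real (Suc m)) * \<bar>w x\<bar>
     - T m * U (\<phi> m x) * (\<bar>w (\<phi> m x) - w x\<bar> * real (Suc m)))" for m x
  define F0 where "F0 x = indicator ?H x * ((real l * U x + gU x \<bullet> P x) * \<bar>w x\<bar> - U x * \<bar>gw x \<bullet> P x\<bar>)" for x
  define C where "C = (2 ^ l * (BG * R) + L * BU) * B0 + 2 ^ l * BU * (Bw * R)"
  have lim: "(\<lambda>m. F m x) \<longlonglongrightarrow> F0 x" for x
  proof (cases "x \<in> ?H")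
    case True
    then have x0: "0 < x \<bullet> u" using \<epsilon> by simp
    have 1: "(\<lambda>m. (U (\<phi> m x) - U x) * real (Suc m)) \<longlonglongrightarrow> gU x \<bullet> P x"
      unfolding \<phi>_def h_def by (rule difference_quotient_LIMSEQ[OF U[OF x0]])
    have 2: "(\<lambda>m. \<bar>(w (\<phi> m x) - w x) * real (Suc m)\<bar>) \<longlonglongrightarrow> \<bar>gw x \<bullet> P x\<bar>"
      unfolding \<phi>_def h_def by (intro tendsto_rabs difference_quotient_LIMSEQ[OF w])
    have "(\<lambda>m. \<phi> m x) \<longlonglongrightarrow> x + 0 *\<^sub>R P x" unfolding \<phi>_def by (intro tendsto_intros limh)
    then have "(\<lambda>m. \<phi> m x) \<longlonglongrightarrow> x" by simp
    then have 3: "(\<lambda>m. U (\<phi> m x)) \<longlonglongrightarrow> U x"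
      using has_derivative_continuous[OF U[OF x0]] by (rule continuous_imp_tendsto[unfolded comp_def, rotated])
    have "(\<lambda>m. (T m * ((U (\<phi> m x) - U x) * real (Suc m)) + (T m - 1) * real (Suc m) * U x) * \<bar>w x\<bar>
        - T m * U (\<phi> m x) * \<bar>(w (\<phi> m x) - w x) * real (Suc m)\<bar>)
      \<longlonglongrightarrow> (1 * (gU x \<bullet> P x) + real l * U x) * \<bar>w x\<bar> - 1 * U x * \<bar>gw x \<bullet> P x\<bar>"
      by (intro tendsto_intros 1 2 3 limT limT1)
    moreover have "(T m * ((U (\<phi> m x) - U x) * real (Suc m)) + (T m - 1) * real (Suc m) * U x) * \<bar>w x\<bar>
        - T m * U (\<phi> m x) * \<bar>(w (\<phi> m x) - w x) * real (Suc m)\<bar> = F m x" for m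
      unfolding F_def abs_mult using True by (simp add: algebra_simps)
    ultimately show ?thesis using True by (simp add: F0_def add.commute)
  qed (simp add: F_def F0_def)
  have bound: "\<bar>F m x\<bar> \<le> C * indicator (cball 0 R) x" for m x
  proof (cases "x \<in> ?H \<and> norm x \<le> R")
    case True
    note K' = inK[of x]
    have "(T m * U (\<phi> m x) - U x) * real (Suc m) =
        T m * ((U (\<phi> m x) - U x) * real (Suc m)) + (T m - 1) * real (Suc m) * U x"
      by (simp add: algebra_simps)
    also have "\<bar>\<dots>\<bar> \<le> T m * (\<bar>U (\<phi> m x) - U x\<bar> * real (Suc m)) + \<bar>(T m - 1) * real (Suc m)\<bar> * U x"
      using T(1)[of m] U0[of x] by (intro order_trans[OF abs_triangle_ineq]) (simp add: abs_mult)
    also have "\<dots> \<le> 2 ^ l * (BG * R) + L * BU"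
    proof (rule add_mono)
      show "T m * (\<bar>U (\<phi> m x) - U x\<bar> * real (Suc m)) \<le> 2 ^ l * (BG * R)"
        using T[of m] True by (intro mult_mono[OF _ dU]) auto
      have "0 \<le> L" using L[of m] abs_ge_zero order_trans by blast
      then show "\<bar>(T m - 1) * real (Suc m)\<bar> * U x \<le> L * BU"
        using True by (intro mult_mono[OF L BU(1)] U0 K'(1)) auto
    qed
    finally have 1: "\<bar>(T m * U (\<phi> m x) - U x) * real (Suc m)\<bar> \<le> 2 ^ l * (BG * R) + L * BU" .
    have "\<bar>F m x\<bar> \<le> \<bar>(T m * U (\<phi> m x) - U x) * real (Suc m)\<bar> * \<bar>w x\<bar>
       + T m * U (\<phi> m x) * (\<bar>w (\<phi> m x) - w x\<bar> * real (Suc m))"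
    proof -
      define a where "a = (T m * U (\<phi> m x) - U x) * real (Suc m)"
      define b where "b = T m * U (\<phi> m x) * (\<bar>w (\<phi> m x) - w x\<bar> * real (Suc m))"
      have "0 \<le> b" unfolding b_def using T(1)[of m] U0[of "\<phi> m x"] by (intro mult_nonneg_nonneg) auto
      moreover have "F m x = a * \<bar>w x\<bar> - b" using True by (simp add: F_def a_def b_def)
      ultimately have "\<bar>F m x\<bar> \<le> \<bar>a\<bar> * \<bar>w x\<bar> + b"
        using abs_triangle_ineq4[of "a * \<bar>w x\<bar>" b] by (simp add: abs_mult)
      then show ?thesis unfolding a_def b_def .
    qed
    also have "\<dots> \<le> (2 ^ l * (BG * R) + L * BU) * B0 + 2 ^ l * BU * (Bw * R)"
    proof (rule add_mono)
      have "0 \<le> 2 ^ l * (BG * R) + L * BU" using 1 abs_ge_zero order_trans by blast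
      then show "\<bar>(T m * U (\<phi> m x) - U x) * real (Suc m)\<bar> * \<bar>w x\<bar> \<le> (2 ^ l * (BG * R) + L * BU) * B0"
        using True R by (intro mult_mono[OF 1 B0(1)]) auto
      have "T m * U (\<phi> m x) \<le> 2 ^ l * BU"
        using True T[of m] by (intro mult_mono[OF _ BU(1)] U0 K'(2)) auto
      then show "T m * U (\<phi> m x) * (\<bar>w (\<phi> m x) - w x\<bar> * real (Suc m)) \<le> 2 ^ l * BU * (Bw * R)"
        using True BU(2) by (intro mult_mono[OF _ dw]) auto
    qed
    finally show ?thesis using True unfolding C_def by simp
  next
    case False
    show ?thesis
    proof (cases "x \<in> ?H")
      case True
      with False have "R < norm x" by simp
      then have "w x = 0" "w (\<phi> m x) = 0" "x \<notin> cball 0 R" using supp \<phi>_ge[of x m] by auto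
      then show ?thesis by (simp add: F_def)
    next
      case outside: False
      have "0 \<le> C" unfolding C_def
        using BG(2) R BU(2) B0(2) Bw(2) L[of 0] by (intro add_nonneg_nonneg mult_nonneg_nonneg) auto
      then show ?thesis using outside by (simp add: F_def)
    qed
  qed
  have Fm[measurable]: "F m \<in> borel_measurable lborel" for m unfolding F_def by measurable
  have intC: "integrable lborel (\<lambda>x::'a. C * indicator (cball 0 R) x)"
    by (intro integrable_mult_right integrable_real_indicator emeasure_bounded_finite) auto
  have F0m: "F0 \<in> borel_measurable lborel"
    by (rule borel_measurable_LIMSEQ_real[OF lim Fm])
  have "(\<lambda>m. \<integral>x. F m x \<partial>lborel) \<longlonglongrightarrow> (\<integral>x. F0 x \<partial>lborel)"
    by (rule integral_dominated_convergence[OF F0m Fm intC]) (use lim bound in auto)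
  moreover have "(\<integral>x. F m x \<partial>lborel) \<le> 0" for m
  proof -
    define f where "f x = indicator ?H x * (U x * \<bar>w x\<bar>)" for x
    have fm[measurable]: "f \<in> borel_measurable borel" unfolding f_def by measurable
    have f0: "f x \<ge> 0" for x using U0 by (simp add: f_def)
    have fi: "integrable lborel f"
    proof (rule integrable_if_bounded_support[of _ R "BU * B0"])
      show "\<bar>f x\<bar> \<le> BU * B0" if "norm x \<le> R" for x
      proof (cases "x \<in> ?H")
        case True
        then show ?thesis using that inK[OF True that] BU B0 U0[of x] R
          by (auto simp: f_def abs_mult intro!: mult_mono)
      qed (use BU B0 in \<open>simp add: f_def\<close>)
    qed (auto simp: f_def supp)
    \<comment> \<open>\<open>T m\<close> is the Jacobian determinant of \<open>\<phi> m\<close>, so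
      the difference quotient of \<open>f\<close> along the dilation has integral zero.\<close>
    have nn: "(\<integral>\<^sup>+x. ennreal (T m * f (\<phi> m x)) \<partial>lborel) = (\<integral>\<^sup>+x. ennreal (f x) \<partial>lborel)"
    proof -
      have "(\<integral>\<^sup>+x. ennreal (T m * f (\<phi> m x)) \<partial>lborel) = ennreal (T m) * (\<integral>\<^sup>+x. ennreal (f (\<phi> m x)) \<partial>lborel)"
        using T(1)[of m] f0 by (subst nn_integral_cmult[symmetric]) (auto simp: ennreal_mult)
      also have "\<dots> = (\<integral>\<^sup>+x. ennreal (f x) \<partial>lborel)"
        using nn_integral_dilation[OF S, of "1 + h m" "\<lambda>x. ennreal (f x)"] h[of m]
        by (simp add: T_def l_def \<phi>_def P_def)
      finally show ?thesis .
    qed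
    have f\<phi>i: "integrable lborel (\<lambda>x. T m * f (\<phi> m x))"
      using fi f0 T(1)[of m] nn
      by (intro integrableI_nonneg) (auto simp: nn_integral_eq_integral less_top[symmetric])
    have "(\<integral>x. T m * f (\<phi> m x) \<partial>lborel) = enn2real (\<integral>\<^sup>+x. ennreal (T m * f (\<phi> m x)) \<partial>lborel)"
      using f0 T(1)[of m] by (intro integral_eq_nn_integral AE_I2) auto
    also have "\<dots> = (\<integral>x. f x \<partial>lborel)"
      unfolding nn using f0 by (intro integral_eq_nn_integral[symmetric] AE_I2) auto
    finally have "(\<integral>x. T m * f (\<phi> m x) \<partial>lborel) = (\<integral>x. f x \<partial>lborel)" .
    then have eq: "(\<integral>x. (T m * f (\<phi> m x) - f x) * real (Suc m) \<partial>lborel) = 0"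
      using fi f\<phi>i by simp
    \<comment> \<open>On the half-space \<open>\<phi> m x\<close> stays inside and the triangle
      inequality applies. Off it \<open>F\<close> and \<open>f x\<close> vanish while
      \<open>f (\<phi> m x) \<ge> 0\<close>: this is the favourable sign of the boundary
      term.\<close>
    have "(\<integral>x. F m x \<partial>lborel) \<le> (\<integral>x. (T m * f (\<phi> m x) - f x) * real (Suc m) \<partial>lborel)"
    proof (rule integral_mono)
      show "integrable lborel (F m)"
        by (rule Bochner_Integration.integrable_bound[OF intC Fm]) (use bound in \<open>auto intro!: AE_I2 order_trans[OF bound]\<close>)
      show "integrable lborel (\<lambda>x. (T m * f (\<phi> m x) - f x) * real (Suc m))"
        using fi f\<phi>i by simp
      fix x
      show "F m x \<le> (T m * f (\<phi> m x) - f x) * real (Suc m)"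
      proof (cases "x \<in> ?H")
        case True
        then have "\<phi> m x \<in> ?H" using \<phi>H[of x m] \<epsilon> by auto
        then have eq: "(T m * f (\<phi> m x) - f x) * real (Suc m) =
            (T m * U (\<phi> m x) * \<bar>w (\<phi> m x)\<bar> - U x * \<bar>w x\<bar>) * real (Suc m)"
          using True by (simp add: f_def)
        have "T m * U (\<phi> m x) * (\<bar>w x\<bar> - \<bar>w (\<phi> m x) - w x\<bar>) \<le> T m * U (\<phi> m x) * \<bar>w (\<phi> m x)\<bar>"
          using T(1)[of m] U0[of "\<phi> m x"] by (intro mult_left_mono) auto
        then have "(T m * U (\<phi> m x) * (\<bar>w x\<bar> - \<bar>w (\<phi> m x) - w x\<bar>) - U x * \<bar>w x\<bar>) * real (Suc m)
          \<le> (T m * U (\<phi> m x) * \<bar>w (\<phi> m x)\<bar> - U x * \<bar>w x\<bar>) * real (Suc m)"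
          by (intro mult_right_mono) auto
        then show ?thesis unfolding eq using True by (simp add: F_def algebra_simps)
      next
        case False
        then show ?thesis using f0[of "\<phi> m x"] T(1)[of m] by (simp add: F_def f_def)
      qed
    qed
    then show ?thesis using eq by simp
  qed
  ultimately have "(\<integral>x. F0 x \<partial>lborel) \<le> 0" by (intro LIMSEQ_le_const2) auto
  then show ?thesis unfolding F0_def l_def .
qed

section \<open>Calculus of partial vectors and of the weight\<close>

lemma abs_nth_le_norm_head_part:
  assumes "1 \<le> k"
  shows "\<bar>x $ e 1\<bar> \<le> norm (head_part e k x)"
proof -
  have "head_part e k x $ e 1 = x $ e 1" using assms by (auto simp: head_part_def)
  then show ?thesis by (metis component_le_norm_cart)
qed

lemma norm_head_part_mono: "k \<le> l \<Longrightarrow> norm (head_part e k x) \<le> norm (head_part e l x)"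
  by (rule norm_le_componentwise_cart) (force simp: head_part_def)

lemma inner_head_part:
  assumes "k \<le> l"
  shows "head_part e k x \<bullet> head_part e l x = (norm (head_part e k x))\<^sup>2"
    and "head_part e l x \<bullet> head_part e k x = (norm (head_part e k x))\<^sup>2"
proof -
  have sub: "e ` {1..k} \<subseteq> e ` {1..l}" using assms by auto
  show *: "head_part e k x \<bullet> head_part e l x = (norm (head_part e k x))\<^sup>2"
    unfolding power2_norm_eq_inner inner_vec_def using sub
    by (intro sum.cong) (auto simp: head_part_def)
  then show "head_part e l x \<bullet> head_part e k x = (norm (head_part e k x))\<^sup>2"
    by (simp add: inner_commute)
qed

lemma inner_head_part_idem: "head_part e k x \<bullet> head_part e k h = head_part e k x \<bullet> h"
  unfolding inner_vec_def by (intro sum.cong) (auto simp: head_part_def)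

lemma bounded_linear_head_part: "bounded_linear (head_part e k :: real ^ 'n::finite \<Rightarrow> real ^ 'n)"
  by (auto simp: linear_conv_bounded_linear[symmetric] linear_iff head_part_def vec_eq_iff)

lemma norm_head_part_pos: "1 \<le> k \<Longrightarrow> x $ e 1 \<noteq> 0 \<Longrightarrow> 0 < norm (head_part e k x)"
  by (rule less_le_trans[OF _ abs_nth_le_norm_head_part]) auto

text \<open>Identifies \<open>head_part e l\<close> with the projection \<open>P\<close> of the
  dilation inequality.\<close>

lemma head_part_eq_sum:
  fixes e :: "nat \<Rightarrow> 'n::finite"
  shows "head_part e l x = (\<Sum>j\<in>(\<lambda>i. axis (e i) 1) ` {1..l}. (x \<bullet> j) *\<^sub>R j)"
proof (rule euclidean_eqI)
  fix b :: "real ^ 'n" assume b: "b \<in> Basis"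
  then obtain j where j: "b = axis j 1" by (auto simp: Basis_vec_def)
  have "(\<Sum>j\<in>(\<lambda>i. axis (e i) 1) ` {1..l}. (x \<bullet> j) *\<^sub>R j) \<bullet> b
      = (if b \<in> (\<lambda>i. axis (e i) 1) ` {1..l} then x \<bullet> b else 0)"
    by (rule inner_sum_Basis_subset) (use b in \<open>auto simp: Basis_vec_def\<close>)
  also have "b \<in> (\<lambda>i. axis (e i) 1) ` {1..l} \<longleftrightarrow> j \<in> e ` {1..l}"
    unfolding j by (auto simp: axis_eq_axis)
  finally show "head_part e l x \<bullet> b = (\<Sum>j\<in>(\<lambda>i. axis (e i) 1) ` {1..l}. (x \<bullet> j) *\<^sub>R j) \<bullet> b"
    by (simp add: j inner_axis head_part_def)
qed

text \<open>Off the hyperplane \<open>x $ e 1 = 0\<close> this is the product of the \<open>norm (head_part e k x) powr s k\<close>.\<close>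

definition log_weight :: "(nat \<Rightarrow> 'n) \<Rightarrow> (nat \<Rightarrow> real) \<Rightarrow> real ^ 'n::finite \<Rightarrow> real" where
  "log_weight e s x = exp (\<Sum>k=1..CARD('n). s k * ln (norm (head_part e k x)))"

text \<open>Logarithmic differentiation: the gradient of ln |X_k| is X_k / |X_k|^2.\<close>

definition log_weight_grad :: "(nat \<Rightarrow> 'n) \<Rightarrow> (nat \<Rightarrow> real) \<Rightarrow> real ^ 'n::finite \<Rightarrow> real ^ 'n" where
  "log_weight_grad e s x = log_weight e s x *\<^sub>R
     (\<Sum>k=1..CARD('n). (s k / (norm (head_part e k x))\<^sup>2) *\<^sub>R head_part e k x)"

text \<open>True on the hyperplane as well, where the product written with \<open>powr\<close> is 0.
  Sign conditions on the weight thus hold at every point.\<close>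

lemma log_weight_pos: "0 < log_weight e s x"
  by (simp add: log_weight_def)

lemma log_weight_measurable [measurable]: "log_weight e s \<in> borel_measurable borel"
proof -
  have [measurable]: "head_part e k \<in> borel_measurable borel" for k
    using bounded_linear_head_part by (intro borel_measurable_continuous_onI linear_continuous_on)
  show ?thesis unfolding log_weight_def by measurable
qed

lemma log_weight_has_derivative:
  fixes e :: "nat \<Rightarrow> 'n::finite"
  assumes "x $ e 1 \<noteq> 0"
  shows "(log_weight e s has_derivative (\<lambda>h. log_weight_grad e s x \<bullet> h)) (at x)"
proof -
  have ln: "((\<lambda>x. ln (norm (head_part e k x))) has_derivative
      (\<lambda>h. (head_part e k x \<bullet> h) / (norm (head_part e k x))\<^sup>2)) (at x)" if k: "k \<in> {1..CARD('n)}" for k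
  proof -
    have p: "0 < norm (head_part e k x)" using norm_head_part_pos[of k x e] assms k by simp
    then have nz: "head_part e k x \<noteq> 0" by auto
    have 1: "(head_part e k has_derivative head_part e k) (at x)"
      using bounded_linear_head_part by (rule bounded_linear_imp_has_derivative)
    have 2: "((\<lambda>x. norm (head_part e k x)) has_derivative (\<lambda>h. head_part e k h \<bullet> sgn (head_part e k x))) (at x)"
      using has_derivative_compose[OF 1 has_derivative_norm[OF nz]] .
    have 3: "(ln has_derivative (*) (inverse (norm (head_part e k x)))) (at (norm (head_part e k x)))"
      using DERIV_ln[OF p] by (simp add: has_field_derivative_def)
    have "head_part e k h \<bullet> head_part e k x = head_part e k x \<bullet> h" for h
      by (metis inner_commute inner_head_part_idem)
    then show ?thesis
      using has_derivative_compose[OF 2 3]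
      by (simp add: sgn_div_norm power2_eq_square divide_inverse mult_ac)
  qed
  have "((\<lambda>x. \<Sum>k=1..CARD('n). s k * ln (norm (head_part e k x))) has_derivative
      (\<lambda>h. \<Sum>k=1..CARD('n). s k * ((head_part e k x \<bullet> h) / (norm (head_part e k x))\<^sup>2))) (at x)"
    by (intro has_derivative_sum has_derivative_mult_right ln)
  from has_derivative_exp[OF this] show ?thesis
    unfolding log_weight_def log_weight_grad_def
    by (simp add: inner_sum_left log_weight_def mult_ac)
qed

lemma continuous_on_log_weight:
  fixes e :: "nat \<Rightarrow> 'n::finite"
  assumes "\<And>x. x \<in> A \<Longrightarrow> x $ e 1 \<noteq> 0"
  shows "continuous_on A (log_weight e s)"
  using log_weight_has_derivative assms
  by (blast intro: continuous_at_imp_continuous_on has_derivative_continuous)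

lemma continuous_on_log_weight_grad:
  fixes e :: "nat \<Rightarrow> 'n::finite"
  assumes "\<And>x. x \<in> A \<Longrightarrow> x $ e 1 \<noteq> 0"
  shows "continuous_on A (log_weight_grad e s)"
proof -
  have "continuous_on A (log_weight e s)"
    using assms by (rule continuous_on_log_weight)
  moreover have "continuous_on A (head_part e k)" for k
    using bounded_linear_head_part by (rule linear_continuous_on)
  moreover have "(norm (head_part e k x))\<^sup>2 \<noteq> 0" if "k \<in> {1..CARD('n)}" "x \<in> A" for k x
    using norm_head_part_pos[of k x e] assms[of x] that by simp
  ultimately show ?thesis
    unfolding log_weight_grad_def by (intro continuous_intros) blast+
qed

text \<open>Dividing by |X_l| stays within the same family of weights, so W / |X_l| inherits the
  derivative formula and can be inserted into the dilation inequality.\<close>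

lemma log_weight_upd:
  fixes e :: "nat \<Rightarrow> 'n::finite"
  assumes l: "l \<in> {1..CARD('n)}" and x: "x $ e 1 \<noteq> 0"
  shows "log_weight e (s(l := s l - 1)) x = log_weight e s x / norm (head_part e l x)"
proof -
  have "(\<Sum>k=1..CARD('n). (s(l := s l - 1)) k * ln (norm (head_part e k x)))
    = (\<Sum>k=1..CARD('n). s k * ln (norm (head_part e k x)) - (if k = l then ln (norm (head_part e l x)) else 0))"
    by (intro sum.cong) (auto simp: algebra_simps)
  also have "\<dots> = (\<Sum>k=1..CARD('n). s k * ln (norm (head_part e k x))) - ln (norm (head_part e l x))"
    using l by (simp add: sum_subtractf)
  finally show ?thesis
    unfolding log_weight_def using norm_head_part_pos[of l x e] l x by (simp add: exp_diff)
qed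

lemma sobolev_weight_eq_log_weight:
  fixes e :: "nat \<Rightarrow> 'n::finite"
  assumes x: "x $ e 1 \<noteq> 0"
  shows "sobolev_weight e a \<sigma> x = log_weight e (\<sigma>(1 := a)) x"
proof -
  have n: "1 \<le> CARD('n)" by (simp add: Suc_leI)
  have h1: "head_part e 1 x = (x $ e 1) *\<^sub>R axis (e 1) 1"
    by (auto simp: head_part_def axis_def vec_eq_iff)
  have "log_weight e (\<sigma>(1 := a)) x = (\<Prod>k=1..CARD('n). norm (head_part e k x) powr ((\<sigma>(1 := a)) k))"
    unfolding log_weight_def using norm_head_part_pos[of _ x e] x
    by (auto simp: exp_sum powr_def intro!: prod.cong)
  also have "\<dots> = norm (head_part e 1 x) powr a * (\<Prod>k=2..CARD('n). norm (head_part e k x) powr \<sigma> k)"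
    using n by (subst prod.atLeast_Suc_atMost) (auto simp: numeral_2_eq_2 intro!: prod.cong)
  also have "norm (head_part e 1 x) = \<bar>x $ e 1\<bar>" unfolding h1 by (simp add: norm_axis_1)
  finally show ?thesis by (simp only: sobolev_weight_def)
qed

text \<open>Back substitution from \<open>l = n\<close> downwards: the inequality for
  \<open>n\<close> has an empty error sum, and each further one only refers to terms already
  bounded. Indices with \<open>\<sigma> l = 0\<close> contribute nothing and need no inequality. The
  constant depends on \<open>c\<close> and \<open>\<sigma>\<close> alone.\<close>

lemma triangular_system_bound:
  fixes c \<sigma> :: "nat \<Rightarrow> real"
  assumes c: "\<And>l. l \<in> {1..n} \<Longrightarrow> \<sigma> l \<noteq> 0 \<Longrightarrow> 0 < c l"
  shows "\<exists>C\<ge>0. \<forall>I L. (\<forall>l\<in>{1..n}. \<sigma> l \<noteq> 0 \<longrightarrow> c l * I l \<le> L + (\<Sum>k\<in>{l<..n}. \<bar>\<sigma> k\<bar> * I k))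
    \<longrightarrow> (\<Sum>k=1..n. \<bar>\<sigma> k\<bar> * I k) \<le> C * L"
proof -
  have "\<exists>C\<ge>0. \<forall>I L. (\<forall>l\<in>{1..n}. \<sigma> l \<noteq> 0 \<longrightarrow> c l * I l \<le> L + (\<Sum>k\<in>{l<..n}. \<bar>\<sigma> k\<bar> * I k))
    \<longrightarrow> (\<Sum>k\<in>{n-j<..n}. \<bar>\<sigma> k\<bar> * I k) \<le> C * L" if "j \<le> n" for j
    using that
  proof (induction j)
    case 0
    then show ?case by (intro exI[of _ 0]) auto
  next
    case (Suc j)
    then obtain C where C: "C \<ge> 0" "\<And>I L. (\<forall>l\<in>{1..n}. \<sigma> l \<noteq> 0 \<longrightarrow> c l * I l \<le> L + (\<Sum>k\<in>{l<..n}. \<bar>\<sigma> k\<bar> * I k))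
      \<Longrightarrow> (\<Sum>k\<in>{n-j<..n}. \<bar>\<sigma> k\<bar> * I k) \<le> C * L" by auto
    define l where "l = n - j"
    have l: "l \<in> {1..n}" using Suc.prems by (auto simp: l_def)
    have set: "{n - Suc j<..n} = insert l {l<..n}" using Suc.prems by (auto simp: l_def)
    define D where "D = (if \<sigma> l = 0 then 0 else \<bar>\<sigma> l\<bar> / c l)"
    have D: "D \<ge> 0" using c[OF l] by (auto simp: D_def)
    show ?case
    \<comment> \<open>The terms above \<open>l\<close> sum to at most \<open>C * L\<close>, and the
      new term is at most \<open>D * (L + C * L)\<close>.\<close>
    proof (intro exI[of _ "C + D * (1 + C)"] conjI allI impI)
      show "0 \<le> C + D * (1 + C)" using C(1) D by simp
      fix I L
      assume H: "\<forall>l\<in>{1..n}. \<sigma> l \<noteq> 0 \<longrightarrow> c l * I l \<le> L + (\<Sum>k\<in>{l<..n}. \<bar>\<sigma> k\<bar> * I k)"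
      have IH: "(\<Sum>k\<in>{l<..n}. \<bar>\<sigma> k\<bar> * I k) \<le> C * L" using C(2)[OF H] by (simp add: l_def)
      have "\<bar>\<sigma> l\<bar> * I l \<le> D * (L + C * L)"
      proof (cases "\<sigma> l = 0")
        case False
        then have "c l * I l \<le> L + C * L" using H l IH by fastforce
        then have "\<bar>\<sigma> l\<bar> / c l * (c l * I l) \<le> \<bar>\<sigma> l\<bar> / c l * (L + C * L)"
          using c[OF l False] by (intro mult_left_mono) auto
        then show ?thesis using False c[OF l False] by (simp add: D_def)
      qed (simp add: D_def)
      then show "(\<Sum>k\<in>{n - Suc j<..n}. \<bar>\<sigma> k\<bar> * I k) \<le> (C + D * (1 + C)) * L"
        unfolding set using IH by (simp add: algebra_simps)
    qed
  qed
  from this[of n] show ?thesis by (simp add: atLeastSucAtMost_greaterThanAtMost)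
qed

text \<open>\<open>V\<close> may be unbounded near the hyperplane, but the support of
  \<open>k\<close> meets \<open>{x. \<epsilon> \<le> x \<bullet> u}\<close> in a compact set on
  which the product is continuous, hence bounded.\<close>

lemma integrable_half_space:
  fixes V k :: "'a::euclidean_space \<Rightarrow> real"
  assumes \<epsilon>: "0 < \<epsilon>" and V: "continuous_on {x. 0 < x \<bullet> u} V" and k: "continuous_on UNIV k"
    and supp: "\<And>x. R < norm x \<Longrightarrow> k x = 0"
  shows "integrable lborel (\<lambda>x. indicator {x. \<epsilon> < x \<bullet> u} x * (V x * k x))"
proof -
  let ?H = "{x. \<epsilon> < x \<bullet> u}"
  define F where "F x = V x * k x" for x
  have cF: "continuous_on {x. 0 < x \<bullet> u} F"
    unfolding F_def by (intro continuous_intros V continuous_on_subset[OF k]) auto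
  have "?H \<subseteq> {x. 0 < x \<bullet> u}" using \<epsilon> by auto
  then have "(\<lambda>x. indicator ?H x *\<^sub>R F x) \<in> borel_measurable borel"
    by (intro borel_measurable_continuous_on_indicator continuous_on_subset[OF cF]) measurable
  moreover have "compact (cball 0 R \<inter> {x. \<epsilon> \<le> x \<bullet> u})"
    by (intro compact_Int_closed compact_cball closed_Collect_le continuous_intros)
  moreover have "cball 0 R \<inter> {x. \<epsilon> \<le> x \<bullet> u} \<subseteq> {x. 0 < x \<bullet> u}" using \<epsilon> by auto
  ultimately obtain B where B: "B \<ge> 0" "\<And>x. x \<in> cball 0 R \<inter> {x. \<epsilon> \<le> x \<bullet> u} \<Longrightarrow> \<bar>F x\<bar> \<le> B"
    using compact_image_bounded[OF _ continuous_on_subset[OF cF]] by (metis real_norm_def)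
  show ?thesis
  proof (rule integrable_if_bounded_support[of _ R B])
    show "(\<lambda>x. indicator ?H x * (V x * k x)) \<in> borel_measurable borel"
      using \<open>(\<lambda>x. indicator ?H x *\<^sub>R F x) \<in> borel_measurable borel\<close> by (simp add: F_def)
    show "\<bar>indicator ?H x * (V x * k x)\<bar> \<le> B" if "norm x \<le> R" for x
      using B(2)[of x] B(1) that by (auto simp: indicator_def F_def)
  qed (simp add: supp)
qed

text \<open>The terms with \<open>k > l\<close> arise because \<open>head_part e k x \<bullet> head_part e l x\<close> is
  \<open>(norm (head_part e l x))\<^sup>2\<close> there. They carry no sign and are absorbed by downward induction on \<open>l\<close>.\<close>

lemma weighted_hardy_step:
  fixes e :: "nat \<Rightarrow> 'n::finite" and \<sigma> :: "nat \<Rightarrow> real" and w :: "real ^ 'n \<Rightarrow> real"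
  assumes e: "inj_on e {1..CARD('n)}" and u: "u = axis (e 1) s" "s \<noteq> 0"
    and \<epsilon>: "0 < \<epsilon>" and R: "0 < R"
    and w: "\<And>x. (w has_derivative (\<lambda>h. gw x \<bullet> h)) (at x)"
    and gw: "continuous_on UNIV gw" and supp: "\<And>x. R < norm x \<Longrightarrow> w x = 0" "\<And>x. R < norm x \<Longrightarrow> gw x = 0"
    and l: "l \<in> {1..CARD('n)}"
  defines "I \<equiv> \<lambda>k. \<integral>x. indicator {x. \<epsilon> < x \<bullet> u} x * (log_weight e \<sigma> x / norm (head_part e k x) * \<bar>w x\<bar>) \<partial>lborel"
    and "L \<equiv> \<integral>x. indicator {x. \<epsilon> < x \<bullet> u} x * (log_weight e \<sigma> x * norm (gw x)) \<partial>lborel"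
  shows "((\<Sum>j=1..l. \<sigma> j) + real l - 1) * I l \<le> L + (\<Sum>k\<in>{l<..CARD('n)}. \<bar>\<sigma> k\<bar> * I k)"
proof -
  let ?H = "{x. \<epsilon> < x \<bullet> u}" and ?n = "CARD('n)"
  have xu: "x \<bullet> u = x $ e 1 * s" for x unfolding u by (simp add: inner_axis)
  have H0: "x $ e 1 \<noteq> 0" if "0 < x \<bullet> u" for x using that unfolding xu by auto
  define W where "W = log_weight e \<sigma>"
  define c where "c = (\<Sum>j=1..l. \<sigma> j) + real l - 1"
  \<comment> \<open>With these exponents \<open>U\<close> is W / |X_l|, so \<open>U\<close> times
    the dilation field is the field W X_l / |X_l|.\<close>
  define s' where "s' = \<sigma>(l := \<sigma> l - 1)"
  define U where "U = log_weight e s'"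
  define gU where "gU = log_weight_grad e s'"
  define S :: "(real ^ 'n) set" where "S = (\<lambda>i. axis (e i) 1) ` {1..l}"
  have P: "(\<Sum>j\<in>S. (x \<bullet> j) *\<^sub>R j) = head_part e l x" for x
    unfolding S_def by (rule head_part_eq_sum[symmetric])
  have "inj_on (\<lambda>i. axis (e i) (1::real)) {1..l}"
  proof (rule inj_onI)
    fix i j assume "i \<in> {1..l}" "j \<in> {1..l}" "axis (e i) (1::real) = axis (e j) 1"
    then show "i = j" using inj_onD[OF e, of i j] l by (simp add: axis_eq_axis)
  qed
  then have cardS: "card S = l" unfolding S_def by (simp add: card_image)
  have cW: "continuous_on {x. 0 < x \<bullet> u} W"
    unfolding W_def by (rule continuous_on_log_weight) (use H0 in auto)
  have cU: "continuous_on {x. 0 < x \<bullet> u} U"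
    unfolding U_def by (rule continuous_on_log_weight) (use H0 in auto)
  have cgU: "continuous_on {x. 0 < x \<bullet> u} gU"
    unfolding gU_def by (rule continuous_on_log_weight_grad) (use H0 in auto)
  have cX: "continuous_on A (head_part e k)" for k A
    using bounded_linear_head_part by (rule linear_continuous_on)
  have cw: "continuous_on UNIV w"
    using w by (auto intro!: continuous_at_imp_continuous_on has_derivative_continuous)
  have intI: "integrable lborel (\<lambda>x. indicator ?H x * (W x / norm (head_part e k x) * \<bar>w x\<bar>))"
    if "1 \<le> k" for k
  proof (rule integrable_half_space[OF \<epsilon>])
    have "\<forall>x\<in>{x. 0 < x \<bullet> u}. norm (head_part e k x) \<noteq> 0"
      using norm_head_part_pos[OF that] H0 by (metis less_irrefl mem_Collect_eq)
    then show "continuous_on {x. 0 < x \<bullet> u} (\<lambda>x. W x / norm (head_part e k x))"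
      by (intro continuous_intros cW cX)
  qed (use supp cw in \<open>auto intro!: continuous_intros\<close>)
  have intL: "integrable lborel (\<lambda>x. indicator ?H x * (W x * norm (gw x)))"
    by (rule integrable_half_space[OF \<epsilon> cW]) (use supp gw in \<open>auto intro!: continuous_intros\<close>)
  have intF: "integrable lborel (\<lambda>x. indicator ?H x *
      ((real l * U x + gU x \<bullet> head_part e l x) * \<bar>w x\<bar> - U x * \<bar>gw x \<bullet> head_part e l x\<bar>))"
  proof -
    have "integrable lborel (\<lambda>x. indicator ?H x * ((real l * U x + gU x \<bullet> head_part e l x) * \<bar>w x\<bar>))"
      by (rule integrable_half_space[OF \<epsilon>]) (use supp cw in \<open>auto intro!: continuous_intros cU cgU cX\<close>)
    moreover have "integrable lborel (\<lambda>x. indicator ?H x * (U x * \<bar>gw x \<bullet> head_part e l x\<bar>))"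
      by (rule integrable_half_space[OF \<epsilon> cU, where R = R]) (use supp gw in \<open>auto intro!: continuous_intros cX\<close>)
    ultimately show ?thesis by (simp add: right_diff_distrib)
  qed
  have le0: "(\<integral>x. indicator ?H x *
      ((real l * U x + gU x \<bullet> head_part e l x) * \<bar>w x\<bar> - U x * \<bar>gw x \<bullet> head_part e l x\<bar>) \<partial>lborel) \<le> 0"
  proof (rule half_space_dilation_inequality[of S u \<epsilon> R U gU w gw, unfolded P cardS])
    show "S \<subseteq> Basis" by (auto simp: S_def Basis_vec_def)
    show "head_part e l x \<bullet> u = x \<bullet> u" for x
      unfolding xu using l by (auto simp: head_part_def)
    show "(U has_derivative (\<lambda>h. gU x \<bullet> h)) (at x)" if "0 < x \<bullet> u" for x
      unfolding U_def gU_def using H0[OF that] by (rule log_weight_has_derivative)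
    show "0 \<le> U x" for x unfolding U_def using log_weight_pos less_imp_le by blast
  qed (use \<epsilon> R cgU w gw supp in \<open>auto simp: U_def\<close>)
  have pt: "c * (W x / norm (head_part e l x) * \<bar>w x\<bar>) - (\<Sum>k\<in>{l<..?n}. \<bar>\<sigma> k\<bar> * (W x / norm (head_part e k x) * \<bar>w x\<bar>))
      - W x * norm (gw x)
    \<le> (real l * U x + gU x \<bullet> head_part e l x) * \<bar>w x\<bar> - U x * \<bar>gw x \<bullet> head_part e l x\<bar>"
    if x: "x \<in> ?H" for x
  proof -
    have x1: "x $ e 1 \<noteq> 0" using H0 x \<epsilon> by auto
    define X where "X k = norm (head_part e k x)" for k
    have X: "X k > 0" if "1 \<le> k" for k unfolding X_def using that x1 by (rule norm_head_part_pos)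
    have W0: "W x > 0" unfolding W_def by (rule log_weight_pos)
    have U: "U x = W x / X l" unfolding U_def W_def X_def s'_def using l x1 by (rule log_weight_upd)
    have U0: "U x > 0" unfolding U_def by (rule log_weight_pos)
    have WU: "W x = U x * X l" using U X[of l] l by simp
    have "gU x \<bullet> head_part e l x = U x * (\<Sum>k=1..?n. s' k / (X k)\<^sup>2 * (head_part e k x \<bullet> head_part e l x))"
      unfolding gU_def log_weight_grad_def U_def X_def by (simp add: inner_sum_left)
    also have "(\<Sum>k=1..?n. s' k / (X k)\<^sup>2 * (head_part e k x \<bullet> head_part e l x))
       = (\<Sum>k=1..l. s' k / (X k)\<^sup>2 * (head_part e k x \<bullet> head_part e l x))
         + (\<Sum>k\<in>{l<..?n}. s' k / (X k)\<^sup>2 * (head_part e k x \<bullet> head_part e l x))"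
    proof -
      have split: "{1..?n} = {1..l} \<union> {l<..?n}" using l by auto
      show ?thesis unfolding split by (rule sum.union_disjoint) auto
    qed
    \<comment> \<open>For \<open>k \<le> l\<close> the inner product is \<open>(X k)\<^sup>2\<close>
      and cancels. The lowered exponent at \<open>l\<close> yields the -1 in \<open>c\<close>, and
      the Jacobian of the dilation yields \<open>real l\<close>.\<close>
    also have "(\<Sum>k=1..l. s' k / (X k)\<^sup>2 * (head_part e k x \<bullet> head_part e l x)) = (\<Sum>k=1..l. s' k)"
      using X by (intro sum.cong) (auto simp: inner_head_part X_def[symmetric] less_imp_neq[symmetric])
    also have "(\<Sum>k=1..l. s' k) = (\<Sum>k=1..l. \<sigma> k - (if k = l then 1 else 0))"
      by (intro sum.cong) (auto simp: s'_def)
    also have "\<dots> = (\<Sum>k=1..l. \<sigma> k) - 1" using l by (simp add: sum_subtractf)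
    also have "(\<Sum>k\<in>{l<..?n}. s' k / (X k)\<^sup>2 * (head_part e k x \<bullet> head_part e l x))
      = (\<Sum>k\<in>{l<..?n}. \<sigma> k / (X k)\<^sup>2 * (X l)\<^sup>2)"
      by (intro sum.cong) (auto simp: s'_def inner_head_part X_def)
    finally have eq: "real l * U x + gU x \<bullet> head_part e l x
       = U x * (c + (\<Sum>k\<in>{l<..?n}. \<sigma> k / (X k)\<^sup>2 * (X l)\<^sup>2))"
      by (simp add: c_def algebra_simps)
    \<comment> \<open>As \<open>X l \<le> X k\<close>, the squared ratio may be replaced by the
      ratio itself; then \<open>U x * (X l / X k)\<close> equals \<open>W x / X k\<close>, the
      integrand of \<open>I k\<close> without \<open>\<bar>w x\<bar>\<close>.\<close>
    have "- (\<Sum>k\<in>{l<..?n}. \<bar>\<sigma> k\<bar> * (X l / X k)) \<le> (\<Sum>k\<in>{l<..?n}. \<sigma> k / (X k)\<^sup>2 * (X l)\<^sup>2)"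
      unfolding sum_negf[symmetric]
    proof (rule sum_mono)
      fix k assume k: "k \<in> {l<..?n}"
      have r: "0 \<le> X l / X k" "X l / X k \<le> 1"
        using X[of l] X[of k] l k norm_head_part_mono[of l k e x] by (auto simp: X_def)
      have "- (\<sigma> k * (X l / X k)\<^sup>2) \<le> \<bar>\<sigma> k\<bar> * (X l / X k)\<^sup>2"
        using mult_right_mono[of "- \<sigma> k" "\<bar>\<sigma> k\<bar>" "(X l / X k)\<^sup>2"] by simp
      also have "\<dots> \<le> \<bar>\<sigma> k\<bar> * (X l / X k)"
        unfolding power2_eq_square using r by (intro mult_left_mono mult_left_le) auto
      finally show "- (\<bar>\<sigma> k\<bar> * (X l / X k)) \<le> \<sigma> k / (X k)\<^sup>2 * (X l)\<^sup>2"
        by (simp add: power_divide)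
    qed
    then have "U x * (c - (\<Sum>k\<in>{l<..?n}. \<bar>\<sigma> k\<bar> * (X l / X k))) * \<bar>w x\<bar>
      \<le> (real l * U x + gU x \<bullet> head_part e l x) * \<bar>w x\<bar>"
      unfolding eq using U0 by (intro mult_right_mono mult_left_mono) auto
    moreover have "U x * (c - (\<Sum>k\<in>{l<..?n}. \<bar>\<sigma> k\<bar> * (X l / X k))) * \<bar>w x\<bar>
      = c * (W x / X l * \<bar>w x\<bar>) - (\<Sum>k\<in>{l<..?n}. \<bar>\<sigma> k\<bar> * (W x / X k * \<bar>w x\<bar>))"
    proof -
      have "U x * (\<Sum>k\<in>{l<..?n}. \<bar>\<sigma> k\<bar> * (X l / X k)) * \<bar>w x\<bar> = (\<Sum>k\<in>{l<..?n}. \<bar>\<sigma> k\<bar> * (W x / X k * \<bar>w x\<bar>))"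
        unfolding sum_distrib_left sum_distrib_right WU by (intro sum.cong) auto
      then show ?thesis using U by (simp add: algebra_simps)
    qed
    moreover have "U x * \<bar>gw x \<bullet> head_part e l x\<bar> \<le> W x * norm (gw x)"
    proof -
      have "U x * \<bar>gw x \<bullet> head_part e l x\<bar> \<le> U x * (norm (gw x) * X l)"
        unfolding X_def using U0 by (intro mult_left_mono Cauchy_Schwarz_ineq2) auto
      then show ?thesis unfolding WU by (simp add: mult_ac)
    qed
    ultimately show ?thesis unfolding X_def by linarith
  qed
  have "(\<integral>x. c * (indicator ?H x * (W x / norm (head_part e l x) * \<bar>w x\<bar>))
      - (\<Sum>k\<in>{l<..?n}. \<bar>\<sigma> k\<bar> * (indicator ?H x * (W x / norm (head_part e k x) * \<bar>w x\<bar>)))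
      - indicator ?H x * (W x * norm (gw x)) \<partial>lborel) \<le> 0"
  proof (rule order_trans[OF integral_mono le0])
    show "integrable lborel (\<lambda>x. c * (indicator ?H x * (W x / norm (head_part e l x) * \<bar>w x\<bar>))
      - (\<Sum>k\<in>{l<..?n}. \<bar>\<sigma> k\<bar> * (indicator ?H x * (W x / norm (head_part e k x) * \<bar>w x\<bar>)))
      - indicator ?H x * (W x * norm (gw x)))"
      using l by (intro Bochner_Integration.integrable_diff integrable_mult_right Bochner_Integration.integrable_sum intI intL) auto
    show "c * (indicator ?H x * (W x / norm (head_part e l x) * \<bar>w x\<bar>))
      - (\<Sum>k\<in>{l<..?n}. \<bar>\<sigma> k\<bar> * (indicator ?H x * (W x / norm (head_part e k x) * \<bar>w x\<bar>)))
      - indicator ?H x * (W x * norm (gw x))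
      \<le> indicator ?H x * ((real l * U x + gU x \<bullet> head_part e l x) * \<bar>w x\<bar> - U x * \<bar>gw x \<bullet> head_part e l x\<bar>)" for x
      using pt[of x] by (cases "x \<in> ?H") auto
  qed (rule intF)
  also have "(\<integral>x. c * (indicator ?H x * (W x / norm (head_part e l x) * \<bar>w x\<bar>))
      - (\<Sum>k\<in>{l<..?n}. \<bar>\<sigma> k\<bar> * (indicator ?H x * (W x / norm (head_part e k x) * \<bar>w x\<bar>)))
      - indicator ?H x * (W x * norm (gw x)) \<partial>lborel) = c * I l - (\<Sum>k\<in>{l<..?n}. \<bar>\<sigma> k\<bar> * I k) - L"
  proof -
    have "integrable lborel (\<lambda>x. \<bar>\<sigma> k\<bar> * (indicator ?H x * (W x / norm (head_part e k x) * \<bar>w x\<bar>)))"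
      if "k \<in> {l<..?n}" for k
      using that l by (intro integrable_mult_right intI) auto
    moreover have "integrable lborel (\<lambda>x. c * (indicator ?H x * (W x / norm (head_part e l x) * \<bar>w x\<bar>)))"
      using l by (intro integrable_mult_right intI) auto
    ultimately show ?thesis
      unfolding I_def L_def W_def[symmetric] using intL
      by (simp only: Bochner_Integration.integral_diff Bochner_Integration.integral_sum
          Bochner_Integration.integrable_diff Bochner_Integration.integrable_sum integral_mult_right_zero)
  qed
  finally show ?thesis unfolding c_def by linarith
qed

section \<open>The weighted inequality\<close>

text \<open>The sign of \<open>s\<close> selects the side of the hyperplane. As
  \<open>\<kappa>\<close> bounds the gradient integral over the whole space, the same number serves
  for both sides.\<close>

lemma half_space_weighted_sobolev:
  fixes e :: "nat \<Rightarrow> 'n::finite" and \<sigma> :: "nat \<Rightarrow> real" and q s :: real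
  assumes e: "inj_on e {1..CARD('n)}" and n: "CARD('n) \<ge> 2"
    and c: "\<forall>l\<in>{1..CARD('n)}. \<sigma> l \<noteq> 0 \<longrightarrow> 0 < (\<Sum>j=1..l. \<sigma> j) + real l - 1"
    and q: "1 < q" "q \<le> real CARD('n) / (real CARD('n) - 1)" and s: "s \<noteq> 0"
  shows "\<exists>C>0. \<forall>w gw R \<kappa>.
    (\<forall>x. (w has_derivative (\<lambda>h. gw x \<bullet> h)) (at x)) \<and> continuous_on UNIV gw \<and>
    (\<forall>x. R < norm x \<longrightarrow> w x = 0 \<and> gw x = 0) \<and> 0 < R \<and> 0 \<le> \<kappa> \<and>
    (\<integral>\<^sup>+x. ennreal (log_weight e \<sigma> x * norm (gw x)) \<partial>lborel) \<le> ennreal \<kappa> \<longrightarrow>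
    (\<integral>\<^sup>+x. ennreal (\<bar>x $ e 1\<bar> powr ((real CARD('n) - 1) * q - real CARD('n)) * (log_weight e \<sigma> x * \<bar>w x\<bar>) powr q)
        * indicator {x. 0 < x $ e 1 * s} x \<partial>lborel) \<le> ennreal ((C * \<kappa>) powr q)"
proof -
  define u :: "real ^ 'n" where "u = axis (e 1) s"
  have xu: "x \<bullet> u = x $ e 1 * s" for x unfolding u_def by (simp add: inner_axis)
  have H0: "x $ e 1 \<noteq> 0" if "0 < x \<bullet> u" for x using that unfolding xu by auto
  have u0: "u \<noteq> 0" using s by (auto simp: u_def axis_eq_0_iff)
  have DIM: "DIM(real ^ 'n) = CARD('n)" by simp
  have i: "axis (e 1) 1 \<in> (Basis :: (real ^ 'n) set)" by (auto simp: Basis_vec_def)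
  obtain C1 where C1: "C1 > 0" "\<forall>f G \<epsilon> R J.
    (\<forall>y. \<epsilon> < y \<bullet> u \<longrightarrow> (f has_derivative (\<lambda>h. G y \<bullet> h)) (at y)) \<and>
    continuous_on {y. \<epsilon> < y \<bullet> u} G \<and> (\<forall>y. R < norm y \<longrightarrow> f y = 0) \<and> f \<in> borel_measurable borel \<and>
    (\<integral>\<^sup>+y. ennreal (norm (G y)) * indicator {y. \<epsilon> < y \<bullet> u} y \<partial>lborel) \<le> ennreal J \<and> 0 \<le> J \<longrightarrow>
    (\<integral>\<^sup>+x. ennreal (\<bar>x \<bullet> axis (e 1) 1\<bar> powr ((real CARD('n) - 1) * q - real CARD('n)) * \<bar>f x\<bar> powr q)
        * indicator {y. \<epsilon> < y \<bullet> u} x \<partial>lborel) \<le> ennreal ((C1 * J) powr q)"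
    using half_space_sobolev[OF i u0, of q, unfolded DIM, OF n q] by (elim exE conjE) (rule that)
  have "\<exists>C\<ge>0. \<forall>I L. (\<forall>l\<in>{1..CARD('n)}. \<sigma> l \<noteq> 0 \<longrightarrow>
      ((\<Sum>j=1..l. \<sigma> j) + real l - 1) * I l \<le> L + (\<Sum>k\<in>{l<..CARD('n)}. \<bar>\<sigma> k\<bar> * I k)) \<longrightarrow>
      (\<Sum>k=1..CARD('n). \<bar>\<sigma> k\<bar> * I k) \<le> C * L"
    by (rule triangular_system_bound) (use c in blast)
  then obtain C2 where C2: "C2 \<ge> 0" "\<forall>I L. (\<forall>l\<in>{1..CARD('n)}. \<sigma> l \<noteq> 0 \<longrightarrow>
      ((\<Sum>j=1..l. \<sigma> j) + real l - 1) * I l \<le> L + (\<Sum>k\<in>{l<..CARD('n)}. \<bar>\<sigma> k\<bar> * I k)) \<longrightarrow>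
      (\<Sum>k=1..CARD('n). \<bar>\<sigma> k\<bar> * I k) \<le> C2 * L"
    by (elim exE conjE) (rule that)
  \<comment> \<open>The gradient of \<open>v = W w\<close> has integral at most \<open>L\<close>
    plus the Hardy sum, that is at most \<open>(1 + C2) * L\<close>; \<open>C1\<close> is the
    constant of the unweighted inequality.\<close>
  define C where "C = C1 * (1 + C2)"
  have C: "C > 0" using C1 C2 by (simp add: C_def add_pos_nonneg)
  show ?thesis
  proof (intro exI[of _ C] conjI C allI impI)
    fix w :: "real ^ 'n \<Rightarrow> real" and gw R \<kappa>
    assume asm: "(\<forall>x. (w has_derivative (\<lambda>h. gw x \<bullet> h)) (at x)) \<and> continuous_on UNIV gw \<and>
      (\<forall>x. R < norm x \<longrightarrow> w x = 0 \<and> gw x = 0) \<and> 0 < R \<and> 0 \<le> \<kappa> \<and>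
      (\<integral>\<^sup>+x. ennreal (log_weight e \<sigma> x * norm (gw x)) \<partial>lborel) \<le> ennreal \<kappa>"
    then have w: "\<And>x. (w has_derivative (\<lambda>h. gw x \<bullet> h)) (at x)" and gw: "continuous_on UNIV gw"
      and supp: "\<And>x. R < norm x \<Longrightarrow> w x = 0" "\<And>x. R < norm x \<Longrightarrow> gw x = 0"
      and R: "0 < R" and lam: "0 \<le> \<kappa>" "(\<integral>\<^sup>+x. ennreal (log_weight e \<sigma> x * norm (gw x)) \<partial>lborel) \<le> ennreal \<kappa>"
      by auto
    have cw: "continuous_on UNIV w"
      using w by (auto intro!: continuous_at_imp_continuous_on has_derivative_continuous)
    have [measurable]: "w \<in> borel_measurable borel" "gw \<in> borel_measurable borel"
      using cw gw by (auto intro: borel_measurable_continuous_onI)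
    define W where "W = log_weight e \<sigma>"
    have Wm[measurable]: "W \<in> borel_measurable borel" unfolding W_def by (rule log_weight_measurable)
    have W0: "W x > 0" for x unfolding W_def by (rule log_weight_pos)
    define \<psi> where "\<psi> x = ennreal (\<bar>x $ e 1\<bar> powr ((real CARD('n) - 1) * q - real CARD('n)) * (W x * \<bar>w x\<bar>) powr q)" for x
    have step: "(\<integral>\<^sup>+x. \<psi> x * indicator {x. \<epsilon> < x \<bullet> u} x \<partial>lborel) \<le> ennreal ((C * \<kappa>) powr q)" if \<epsilon>: "0 < \<epsilon>" for \<epsilon>
    proof -
      let ?H = "{x. \<epsilon> < x \<bullet> u}"
      define I where "I k = (\<integral>x. indicator ?H x * (W x / norm (head_part e k x) * \<bar>w x\<bar>) \<partial>lborel)" for k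
      define L where "L = (\<integral>x. indicator ?H x * (W x * norm (gw x)) \<partial>lborel)"
      have sum: "(\<Sum>k=1..CARD('n). \<bar>\<sigma> k\<bar> * I k) \<le> C2 * L"
        by (rule C2(2)[THEN spec, THEN spec, THEN mp]) (use weighted_hardy_step[OF e u_def s \<epsilon> R w gw supp] in \<open>auto simp: I_def L_def W_def\<close>)
      have cW: "continuous_on {x. 0 < x \<bullet> u} W"
        unfolding W_def by (rule continuous_on_log_weight) (use H0 in auto)
      have cX: "continuous_on A (head_part e k)" for k A
        using bounded_linear_head_part by (rule linear_continuous_on)
      have intI: "integrable lborel (\<lambda>x. indicator ?H x * (W x / norm (head_part e k x) * \<bar>w x\<bar>))"
        if "1 \<le> k" for k
      proof (rule integrable_half_space[OF \<epsilon>])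
        have "\<forall>x\<in>{x. 0 < x \<bullet> u}. norm (head_part e k x) \<noteq> 0"
          using norm_head_part_pos[OF that] H0 by (metis less_irrefl mem_Collect_eq)
        then show "continuous_on {x. 0 < x \<bullet> u} (\<lambda>x. W x / norm (head_part e k x))"
          by (intro continuous_intros cW cX)
      qed (use supp cw in \<open>auto intro!: continuous_intros\<close>)
      have intL: "integrable lborel (\<lambda>x. indicator ?H x * (W x * norm (gw x)))"
        by (rule integrable_half_space[OF \<epsilon> cW, where R = R]) (use supp gw in \<open>auto intro!: continuous_intros\<close>)
      have Llam: "L \<le> \<kappa>" "0 \<le> L"
      proof -
        show "0 \<le> L" unfolding L_def using W0 by (intro integral_nonneg_AE AE_I2) (simp add: less_imp_le)
        have "ennreal L = (\<integral>\<^sup>+x. ennreal (indicator ?H x * (W x * norm (gw x))) \<partial>lborel)"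
          unfolding L_def using W0 by (intro nn_integral_eq_integral[symmetric] intL AE_I2) (simp add: less_imp_le)
        also have "\<dots> \<le> (\<integral>\<^sup>+x. ennreal (log_weight e \<sigma> x * norm (gw x)) \<partial>lborel)"
          unfolding W_def[symmetric] using W0
          by (intro nn_integral_mono ennreal_leI) (auto simp: indicator_def less_imp_le)
        finally show "L \<le> \<kappa>" using lam by (meson ennreal_le_iff order_trans)
      qed
      define v where "v x = W x * w x" for x
      define G where "G x = W x *\<^sub>R gw x + w x *\<^sub>R log_weight_grad e \<sigma> x" for x
      have der: "(v has_derivative (\<lambda>h. G x \<bullet> h)) (at x)" if "\<epsilon> < x \<bullet> u" for x
      proof -
        have "(W has_derivative (\<lambda>h. log_weight_grad e \<sigma> x \<bullet> h)) (at x)"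
          unfolding W_def by (rule log_weight_has_derivative) (use H0 that \<epsilon> in auto)
        from has_derivative_mult[OF this w] show ?thesis
          unfolding v_def G_def by (simp add: inner_add_left mult.commute)
      qed
      have contG: "continuous_on ?H G"
      proof -
        have "?H \<subseteq> {x. 0 < x \<bullet> u}" using \<epsilon> by auto
        moreover have "continuous_on ?H (log_weight_grad e \<sigma>)"
          by (rule continuous_on_log_weight_grad) (use H0 \<epsilon> in auto)
        ultimately show ?thesis
          unfolding G_def using continuous_on_subset[OF cW] continuous_on_subset[OF gw] continuous_on_subset[OF cw]
          by (intro continuous_intros) auto
      qed
      have normG: "norm (G x) \<le> W x * norm (gw x) + (\<Sum>k=1..CARD('n). \<bar>\<sigma> k\<bar> * (W x / norm (head_part e k x) * \<bar>w x\<bar>))" for x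
      proof -
        have "norm (\<Sum>k=1..CARD('n). (\<sigma> k / (norm (head_part e k x))\<^sup>2) *\<^sub>R head_part e k x)
          \<le> (\<Sum>k=1..CARD('n). \<bar>\<sigma> k\<bar> / norm (head_part e k x))"
          by (intro order_trans[OF norm_sum] sum_mono) (simp add: power2_eq_square)
        then have "\<bar>w x\<bar> * (W x * norm (\<Sum>k=1..CARD('n). (\<sigma> k / (norm (head_part e k x))\<^sup>2) *\<^sub>R head_part e k x))
          \<le> \<bar>w x\<bar> * (W x * (\<Sum>k=1..CARD('n). \<bar>\<sigma> k\<bar> / norm (head_part e k x)))"
          using W0[of x] by (intro mult_left_mono) auto
        also have "\<dots> = (\<Sum>k=1..CARD('n). \<bar>\<sigma> k\<bar> * (W x / norm (head_part e k x) * \<bar>w x\<bar>))"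
          unfolding sum_distrib_left by (intro sum.cong) auto
        finally show ?thesis
          unfolding G_def log_weight_grad_def W_def[symmetric] using W0[of x]
          by (intro order_trans[OF norm_triangle_ineq]) (simp add: abs_mult mult.assoc)
      qed
      have "(\<integral>\<^sup>+y. ennreal (norm (G y)) * indicator ?H y \<partial>lborel)
        \<le> (\<integral>\<^sup>+y. ennreal (indicator ?H y * (W y * norm (gw y)) + (\<Sum>k=1..CARD('n). \<bar>\<sigma> k\<bar> *
             (indicator ?H y * (W y / norm (head_part e k y) * \<bar>w y\<bar>)))) \<partial>lborel)"
      proof (rule nn_integral_mono)
        fix y
        show "ennreal (norm (G y)) * indicator ?H y \<le> ennreal (indicator ?H y * (W y * norm (gw y)) + (\<Sum>k=1..CARD('n). \<bar>\<sigma> k\<bar> *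
             (indicator ?H y * (W y / norm (head_part e k y) * \<bar>w y\<bar>))))"
          using normG[of y] by (cases "y \<in> ?H") (auto intro!: ennreal_leI)
      qed
      also have "\<dots> = ennreal (L + (\<Sum>k=1..CARD('n). \<bar>\<sigma> k\<bar> * I k))"
      proof -
        have 1: "integrable lborel (\<lambda>y. \<bar>\<sigma> k\<bar> * (indicator ?H y * (W y / norm (head_part e k y) * \<bar>w y\<bar>)))"
          if "k \<in> {1..CARD('n)}" for k using that by (intro integrable_mult_right intI) auto
        have "(\<integral>y. indicator ?H y * (W y * norm (gw y)) + (\<Sum>k=1..CARD('n). \<bar>\<sigma> k\<bar> *
             (indicator ?H y * (W y / norm (head_part e k y) * \<bar>w y\<bar>))) \<partial>lborel) = L + (\<Sum>k=1..CARD('n). \<bar>\<sigma> k\<bar> * I k)"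
          unfolding L_def I_def using 1 intL
          by (simp only: Bochner_Integration.integral_add Bochner_Integration.integral_sum
              Bochner_Integration.integrable_add Bochner_Integration.integrable_sum integral_mult_right_zero)
        moreover have "0 \<le> indicator ?H y * (W y * norm (gw y)) + (\<Sum>k=1..CARD('n). \<bar>\<sigma> k\<bar> *
             (indicator ?H y * (W y / norm (head_part e k y) * \<bar>w y\<bar>)))" for y
          using W0[of y] by (intro add_nonneg_nonneg sum_nonneg mult_nonneg_nonneg) auto
        ultimately show ?thesis using 1 intL
          by (subst nn_integral_eq_integral) (auto intro!: Bochner_Integration.integrable_add Bochner_Integration.integrable_sum)
      qed
      also have "\<dots> \<le> ennreal ((1 + C2) * \<kappa>)"
      proof (rule ennreal_leI)
        have "L + (\<Sum>k=1..CARD('n). \<bar>\<sigma> k\<bar> * I k) \<le> (1 + C2) * L" using sum by (simp add: algebra_simps)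
        also have "\<dots> \<le> (1 + C2) * \<kappa>" using Llam C2(1) by (intro mult_left_mono) auto
        finally show "L + (\<Sum>k=1..CARD('n). \<bar>\<sigma> k\<bar> * I k) \<le> (1 + C2) * \<kappa>" .
      qed
      finally have J: "(\<integral>\<^sup>+y. ennreal (norm (G y)) * indicator ?H y \<partial>lborel) \<le> ennreal ((1 + C2) * \<kappa>)" .
      have vm: "v \<in> borel_measurable borel" unfolding v_def by measurable
      have "(\<integral>\<^sup>+x. ennreal (\<bar>x \<bullet> axis (e 1) 1\<bar> powr ((real CARD('n) - 1) * q - real CARD('n)) * \<bar>v x\<bar> powr q)
        * indicator ?H x \<partial>lborel) \<le> ennreal ((C1 * ((1 + C2) * \<kappa>)) powr q)"
        by (rule C1(2)[THEN spec[of _ v], THEN spec[of _ G], THEN spec[of _ \<epsilon>], THEN spec[of _ R], THEN spec, THEN mp]) (use der contG supp vm J lam(1) C2(1) in \<open>auto simp: v_def\<close>)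
      then show ?thesis
        using W0 by (simp add: \<psi>_def C_def v_def inner_axis abs_mult less_imp_le mult.assoc)
    qed
    have [measurable]: "\<psi> \<in> borel_measurable borel" unfolding \<psi>_def by measurable
    \<comment> \<open>The bound in \<open>step\<close> does not depend on \<open>\<epsilon>\<close>,
      so it passes to the open half-space by monotone convergence along
      \<open>\<epsilon> = 1 / Suc m\<close>.\<close>
    have "(\<integral>\<^sup>+x. \<psi> x * indicator {x. 0 < x \<bullet> u} x \<partial>lborel)
      = (\<integral>\<^sup>+x. (SUP m. \<psi> x * indicator {x. 1 / real (Suc m) < x \<bullet> u} x) \<partial>lborel)"
    proof (rule nn_integral_cong)
      fix x
      show "\<psi> x * indicator {x. 0 < x \<bullet> u} x = (SUP m. \<psi> x * indicator {x. 1 / real (Suc m) < x \<bullet> u} x)"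
      proof (cases "0 < x \<bullet> u")
        case True
        then obtain m where m: "1 / real (Suc m) < x \<bullet> u" using nat_approx_posE by blast
        show ?thesis
        proof (rule antisym)
          show "\<psi> x * indicator {x. 0 < x \<bullet> u} x \<le> (SUP m. \<psi> x * indicator {x. 1 / real (Suc m) < x \<bullet> u} x)"
            by (rule SUP_upper2[of m]) (use m True in auto)
          show "(SUP m. \<psi> x * indicator {x. 1 / real (Suc m) < x \<bullet> u} x) \<le> \<psi> x * indicator {x. 0 < x \<bullet> u} x"
            by (rule SUP_least) (use True in \<open>auto simp: indicator_def\<close>)
        qed
      next
        case False
        have "\<not> 1 / real (Suc m) < x \<bullet> u" for m
          using False zero_less_divide_1_iff[of "real (Suc m)"] by (metis of_nat_0_less_iff order_less_trans zero_less_Suc)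
        then show ?thesis using False by simp
      qed
    qed
    also have "\<dots> = (SUP m. \<integral>\<^sup>+x. \<psi> x * indicator {x. 1 / real (Suc m) < x \<bullet> u} x \<partial>lborel)"
    proof (rule nn_integral_monotone_convergence_SUP)
      show "incseq (\<lambda>m x. \<psi> x * indicator {x. 1 / real (Suc m) < x \<bullet> u} x)"
      proof (intro incseq_SucI le_funI)
        fix m x
        have "1 / real (Suc (Suc m)) \<le> 1 / real (Suc m)" by (intro divide_left_mono) auto
        then show "\<psi> x * indicator {x. 1 / real (Suc m) < x \<bullet> u} x \<le> \<psi> x * indicator {x. 1 / real (Suc (Suc m)) < x \<bullet> u} x"
          by (intro mult_left_mono) (auto simp: indicator_def simp del: of_nat_Suc)
      qed
    qed measurable
    also have "\<dots> \<le> ennreal ((C * \<kappa>) powr q)"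
      by (rule SUP_least) (rule step, simp)
    finally show "(\<integral>\<^sup>+x. ennreal (\<bar>x $ e 1\<bar> powr ((real CARD('n) - 1) * q - real CARD('n)) * (log_weight e \<sigma> x * \<bar>w x\<bar>) powr q)
        * indicator {x. 0 < x $ e 1 * s} x \<partial>lborel) \<le> ennreal ((C * \<kappa>) powr q)"
      unfolding \<psi>_def W_def xu .
  qed
qed

section \<open>From test functions to the theorem\<close>

text \<open>\<open>grad\<close> is a definite description, so it first has to be identified with the
  vector of directional derivatives along \<open>Basis\<close>. Its continuity follows because
  \<open>Ck_fun\<close> makes each directional derivative continuous.\<close>

lemma test_function_gradient:
  fixes w :: "'a::euclidean_space \<Rightarrow> real"
  assumes "test_function w"
  obtains R where "0 < R" "\<And>x. R < norm x \<Longrightarrow> w x = 0 \<and> grad w x = 0"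
    "\<And>x. (w has_derivative (\<lambda>h. grad w x \<bullet> h)) (at x)" "continuous_on UNIV (grad w)"
proof -
  have "Ck_fun (Suc 0) w" and comp: "compact (closure {x. w x \<noteq> 0})"
    using assms by (auto simp: test_function_def simp del: Ck_fun.simps)
  then have diff: "w differentiable (at x)" and cont: "continuous_on UNIV (\<lambda>x. frechet_derivative w (at x) v)" for x v
    by auto
  define g where "g x = (\<Sum>b\<in>Basis. frechet_derivative w (at x) b *\<^sub>R b)" for x
  have der: "(w has_derivative (\<lambda>h. g x \<bullet> h)) (at x)" for x
  proof -
    have D: "(w has_derivative frechet_derivative w (at x)) (at x)"
      using diff frechet_derivative_works by blast
    then interpret bounded_linear "frechet_derivative w (at x)" by (rule has_derivative_bounded_linear)
    have "frechet_derivative w (at x) h = g x \<bullet> h" for h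
    proof -
      have "frechet_derivative w (at x) h = frechet_derivative w (at x) (\<Sum>b\<in>Basis. (h \<bullet> b) *\<^sub>R b)"
        by (simp add: euclidean_representation)
      also have "\<dots> = g x \<bullet> h"
        by (simp add: sum scaleR g_def inner_sum_left inner_commute[of h] mult.commute)
      finally show ?thesis .
    qed
    then have "frechet_derivative w (at x) = (\<lambda>h. g x \<bullet> h)" by (rule ext)
    then show ?thesis using D by simp
  qed
  have uniq: "D = g x" if "(w has_derivative (\<lambda>h. D \<bullet> h)) (at x)" for D x
  proof -
    have "(\<lambda>h. D \<bullet> h) = (\<lambda>h. g x \<bullet> h)" using has_derivative_unique[OF that der] .
    then show ?thesis by (metis vector_eq_rdot inner_commute)
  qed
  have grad: "grad w x = g x" for x
    unfolding grad_def gderiv_def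
    by (rule the_equality) (use der uniq in \<open>simp_all add: inner_commute\<close>)
  have cg: "continuous_on UNIV g" unfolding g_def by (intro continuous_intros cont)
  obtain R where R: "0 < R" "\<And>x. x \<in> closure {x. w x \<noteq> 0} \<Longrightarrow> norm x \<le> R"
    using compact_imp_bounded[OF comp] unfolding bounded_pos by blast
  have w0: "w x = 0" if "R < norm x" for x
    using R(2)[of x] that closure_subset[of "{x. w x \<noteq> 0}"] by force
  have g0: "g x = 0" if "R < norm x" for x
  proof -
    have "open {y::'a. R < norm y}" by (intro open_Collect_less continuous_intros)
    then have "((\<lambda>y. 0) has_derivative (\<lambda>h. g x \<bullet> h)) (at x)"
      using has_derivative_transform_within_open[OF der, of "{y. R < norm y}" x "\<lambda>_. 0"] that w0 by simp
    then have "(\<lambda>h. g x \<bullet> h) = (\<lambda>h. 0)" using has_derivative_unique has_derivative_const by blast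
    then show ?thesis by (metis inner_eq_zero_iff)
  qed
  show ?thesis
    using that[of R] R(1) w0 g0 der cg unfolding grad[abs_def] by (simp add: grad)
qed

lemma AE_nth_neq_0:
  fixes i :: "'n::finite"
  shows "AE x in lborel. (x :: real ^ 'n) $ i \<noteq> 0"
proof -
  have "negligible {x :: real ^ 'n. x $ i = 0}" by (rule negligible_standard_hyperplane_cart)
  moreover have m: "{x :: real ^ 'n. x $ i = 0} \<in> sets lborel" by measurable
  ultimately have "{x :: real ^ 'n. x $ i = 0} \<in> null_sets lborel"
    by (simp add: negligible_iff_null_sets null_sets_def)
  then show ?thesis by (rule AE_I') auto
qed

theorem theorem3p2:
  fixes n :: nat and e :: "nat \<Rightarrow> 'n::finite" and \<sigma> :: "nat \<Rightarrow> real" and q b :: real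
  assumes "n = CARD('n)" and "n \<ge> 2"
    and "bij_betw e {1..n} (UNIV :: 'n set)"
    and "\<And>l. l \<in> {1..n} \<Longrightarrow> \<sigma> l \<noteq> 0 \<Longrightarrow> (\<Sum>j=1..l. \<sigma> j) + real l - 1 > 0"
    and "1 < q" and "q \<le> real n / (real n - 1)"
    and "b = \<sigma> 1 - 1 + (q - 1) / q * real n"
  shows "\<exists>C::real. C > 0 \<and>
    (\<forall>w :: real ^ 'n \<Rightarrow> real. test_function w \<longrightarrow>
      (\<integral>\<^sup>+ x. ennreal (sobolev_weight e (\<sigma> 1) \<sigma> x * norm (grad w x)) \<partial>lborel)
      \<ge> ennreal C *
        ennpowr (\<integral>\<^sup>+ x. ennreal ((sobolev_weight e b \<sigma> x * \<bar>w x\<bar>) powr q) \<partial>lborel) (1 / q))"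
proof -
  have n: "CARD('n) \<ge> 2" and e: "inj_on e {1..CARD('n)}"
    and c: "\<forall>l\<in>{1..CARD('n)}. \<sigma> l \<noteq> 0 \<longrightarrow> 0 < (\<Sum>j=1..l. \<sigma> j) + real l - 1"
    and q: "1 < q" "q \<le> real CARD('n) / (real CARD('n) - 1)"
    using assms by (auto simp: bij_betw_def)
  define \<psi> where "\<psi> w x = ennreal (\<bar>x $ e 1\<bar> powr ((real CARD('n) - 1) * q - real CARD('n)) * (log_weight e \<sigma> x * \<bar>w x\<bar>) powr q)"
    for w :: "real ^ 'n \<Rightarrow> real" and x
  have "\<exists>C>0. \<forall>w \<kappa>. test_function w \<and> 0 \<le> \<kappa> \<and>
      (\<integral>\<^sup>+x. ennreal (log_weight e \<sigma> x * norm (grad w x)) \<partial>lborel) \<le> ennreal \<kappa> \<longrightarrow>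
      (\<integral>\<^sup>+x. \<psi> w x * indicator {x. 0 < x $ e 1 * s} x \<partial>lborel) \<le> ennreal ((C * \<kappa>) powr q)"
    if s: "s \<noteq> 0" for s
  proof -
    obtain C where C: "C > 0" "\<forall>w gw R \<kappa>.
      (\<forall>x. (w has_derivative (\<lambda>h. gw x \<bullet> h)) (at x)) \<and> continuous_on UNIV gw \<and>
      (\<forall>x. R < norm x \<longrightarrow> w x = 0 \<and> gw x = 0) \<and> 0 < R \<and> 0 \<le> \<kappa> \<and>
      (\<integral>\<^sup>+x. ennreal (log_weight e \<sigma> x * norm (gw x)) \<partial>lborel) \<le> ennreal \<kappa> \<longrightarrow>
      (\<integral>\<^sup>+x. \<psi> w x * indicator {x. 0 < x $ e 1 * s} x \<partial>lborel) \<le> ennreal ((C * \<kappa>) powr q)"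
      using half_space_weighted_sobolev[OF e n c q s] by (elim exE conjE) (rule that[unfolded \<psi>_def])
    show ?thesis
    proof (intro exI[of _ C] conjI C(1) allI impI)
      fix w :: "real ^ 'n \<Rightarrow> real" and \<kappa>
      assume w: "test_function w \<and> 0 \<le> \<kappa> \<and>
        (\<integral>\<^sup>+x. ennreal (log_weight e \<sigma> x * norm (grad w x)) \<partial>lborel) \<le> ennreal \<kappa>"
      then obtain R where "0 < R" "\<And>x. R < norm x \<Longrightarrow> w x = 0 \<and> grad w x = 0"
        "\<And>x. (w has_derivative (\<lambda>h. grad w x \<bullet> h)) (at x)" "continuous_on UNIV (grad w)"
        using test_function_gradient by blast
      with w show "(\<integral>\<^sup>+x. \<psi> w x * indicator {x. 0 < x $ e 1 * s} x \<partial>lborel) \<le> ennreal ((C * \<kappa>) powr q)"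
        by (intro C(2)[THEN spec[of _ w], THEN spec[of _ "grad w"], THEN spec[of _ R], THEN spec, THEN mp]) simp
    qed
  qed
  from this[of 1] this[of "-1"] obtain C1 C2 where
    C1: "C1 > 0" "\<And>w \<kappa>. test_function w \<Longrightarrow> 0 \<le> \<kappa> \<Longrightarrow>
      (\<integral>\<^sup>+x. ennreal (log_weight e \<sigma> x * norm (grad w x)) \<partial>lborel) \<le> ennreal \<kappa> \<Longrightarrow>
      (\<integral>\<^sup>+x. \<psi> w x * indicator {x. 0 < x $ e 1 * 1} x \<partial>lborel) \<le> ennreal ((C1 * \<kappa>) powr q)" and
    C2: "C2 > 0" "\<And>w \<kappa>. test_function w \<Longrightarrow> 0 \<le> \<kappa> \<Longrightarrow>
      (\<integral>\<^sup>+x. ennreal (log_weight e \<sigma> x * norm (grad w x)) \<partial>lborel) \<le> ennreal \<kappa> \<Longrightarrow>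
      (\<integral>\<^sup>+x. \<psi> w x * indicator {x. 0 < x $ e 1 * - 1} x \<partial>lborel) \<le> ennreal ((C2 * \<kappa>) powr q)"
    by auto
  define C where "C = C1 + C2"
  have C: "C > 0" using C1(1) C2(1) by (simp add: C_def)
  show ?thesis
  \<comment> \<open>\<open>C\<close> dominates the constants of both sides, and adding them gives
    \<open>2 * (C * \<kappa>) powr q\<close>, which is at most
    \<open>(2 * C * \<kappa>) powr q\<close> since \<open>q > 1\<close>.\<close>
  proof (intro exI[of _ "1 / (2 * C)"] conjI allI impI)
    show "1 / (2 * C) > 0" using C by simp
    fix w :: "real ^ 'n \<Rightarrow> real"
    assume w: "test_function w"
    define \<Lambda> where "\<Lambda> = (\<integral>\<^sup>+x. ennreal (sobolev_weight e (\<sigma> 1) \<sigma> x * norm (grad w x)) \<partial>lborel)"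
    define X where "X = (\<integral>\<^sup>+x. ennreal ((sobolev_weight e b \<sigma> x * \<bar>w x\<bar>) powr q) \<partial>lborel)"
    show "ennreal (1 / (2 * C)) * ennpowr X (1 / q) \<le> \<Lambda>"
    proof (cases "\<Lambda> = \<infinity>")
      case False
      define \<kappa> where "\<kappa> = enn2real \<Lambda>"
      have lam: "\<Lambda> = ennreal \<kappa>" "0 \<le> \<kappa>" using False by (auto simp: \<kappa>_def less_top)
      have le: "(\<integral>\<^sup>+x. ennreal (log_weight e \<sigma> x * norm (grad w x)) \<partial>lborel) \<le> ennreal \<kappa>"
      proof -
        have "\<Lambda> = (\<integral>\<^sup>+x. ennreal (log_weight e \<sigma> x * norm (grad w x)) \<partial>lborel)"
          unfolding \<Lambda>_def
        proof (rule nn_integral_cong_AE)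
          show "AE x in lborel. ennreal (sobolev_weight e (\<sigma> 1) \<sigma> x * norm (grad w x))
            = ennreal (log_weight e \<sigma> x * norm (grad w x))"
            using AE_nth_neq_0[of "e 1"] by eventually_elim (simp add: sobolev_weight_eq_log_weight)
        qed
        then show ?thesis by (simp add: lam)
      qed
      have "X \<le> (\<integral>\<^sup>+x. \<psi> w x * indicator {x. 0 < x $ e 1 * 1} x + \<psi> w x * indicator {x. 0 < x $ e 1 * - 1} x \<partial>lborel)"
        unfolding X_def
      proof (rule nn_integral_mono_AE)
        show "AE x in lborel. ennreal ((sobolev_weight e b \<sigma> x * \<bar>w x\<bar>) powr q)
          \<le> \<psi> w x * indicator {x. 0 < x $ e 1 * 1} x + \<psi> w x * indicator {x. 0 < x $ e 1 * - 1} x"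
          using AE_nth_neq_0[of "e 1"]
        proof eventually_elim
          fix x :: "real ^ 'n" assume x: "x $ e 1 \<noteq> 0"
          have "sobolev_weight e b \<sigma> x = \<bar>x $ e 1\<bar> powr (b - \<sigma> 1) * sobolev_weight e (\<sigma> 1) \<sigma> x"
            using x by (simp add: sobolev_weight_def powr_diff)
          also have "sobolev_weight e (\<sigma> 1) \<sigma> x = log_weight e \<sigma> x"
            using sobolev_weight_eq_log_weight[of x e "\<sigma> 1" \<sigma>] x by simp
          finally have sw: "sobolev_weight e b \<sigma> x = \<bar>x $ e 1\<bar> powr (b - \<sigma> 1) * log_weight e \<sigma> x" .
          \<comment> \<open>The prescribed value of \<open>b\<close> enters here: it matches the
            exponent dictated by the ball growth.\<close>
          have "(b - \<sigma> 1) * q = (real CARD('n) - 1) * q - real CARD('n)"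
            using assms(1,7) q(1) by (simp add: field_simps)
          then have "ennreal ((sobolev_weight e b \<sigma> x * \<bar>w x\<bar>) powr q) = \<psi> w x"
            unfolding sw \<psi>_def using log_weight_pos[of e \<sigma> x]
            by (simp add: powr_mult powr_powr mult.assoc)
          then show "ennreal ((sobolev_weight e b \<sigma> x * \<bar>w x\<bar>) powr q)
            \<le> \<psi> w x * indicator {x. 0 < x $ e 1 * 1} x + \<psi> w x * indicator {x. 0 < x $ e 1 * - 1} x"
            using x by (auto simp: indicator_def)
        qed
      qed
      also have "\<dots> = (\<integral>\<^sup>+x. \<psi> w x * indicator {x. 0 < x $ e 1 * 1} x \<partial>lborel)
          + (\<integral>\<^sup>+x. \<psi> w x * indicator {x. 0 < x $ e 1 * - 1} x \<partial>lborel)"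
      proof (rule nn_integral_add)
        have "Ck_fun 0 w" using w by (simp only: test_function_def)
        then have [measurable]: "w \<in> borel_measurable borel"
          by (simp add: borel_measurable_continuous_onI)
        have [measurable]: "\<psi> w \<in> borel_measurable borel" unfolding \<psi>_def by measurable
        show "(\<lambda>x. \<psi> w x * indicator {x. 0 < x $ e 1 * 1} x) \<in> borel_measurable lborel"
          "(\<lambda>x. \<psi> w x * indicator {x. 0 < x $ e 1 * - 1} x) \<in> borel_measurable lborel"
          by measurable
      qed
      also have "\<dots> \<le> ennreal ((C1 * \<kappa>) powr q) + ennreal ((C2 * \<kappa>) powr q)"
        using C1(2)[OF w lam(2) le] C2(2)[OF w lam(2) le] by (rule add_mono)
      also have "\<dots> \<le> ennreal ((2 * C * \<kappa>) powr q)"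
      proof -
        have "(C1 * \<kappa>) powr q \<le> (C * \<kappa>) powr q" "(C2 * \<kappa>) powr q \<le> (C * \<kappa>) powr q"
          using C1(1) C2(1) lam(2) q by (auto simp: C_def intro!: powr_mono2 mult_right_mono)
        then have "(C1 * \<kappa>) powr q + (C2 * \<kappa>) powr q \<le> 2 * (C * \<kappa>) powr q" by simp
        also have "\<dots> \<le> 2 powr q * (C * \<kappa>) powr q"
          using powr_mono[of 1 q 2] q by (intro mult_right_mono) auto
        also have "\<dots> = (2 * C * \<kappa>) powr q" using C lam(2) by (simp add: powr_mult mult.assoc)
        finally show ?thesis by (simp add: ennreal_plus[symmetric] ennreal_leI del: ennreal_plus)
      qed
      finally have X: "X \<le> ennreal ((2 * C * \<kappa>) powr q)" .
      then have "X \<noteq> \<infinity>" by (auto simp: top_unique)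
      moreover have "enn2real X powr (1 / q) \<le> 2 * C * \<kappa>"
      proof -
        have "enn2real X \<le> (2 * C * \<kappa>) powr q" using enn2real_mono[OF X] by simp
        then have "enn2real X powr (1 / q) \<le> ((2 * C * \<kappa>) powr q) powr (1 / q)"
          using q by (intro powr_mono2) auto
        also have "\<dots> = 2 * C * \<kappa>" using q C lam(2) by (simp add: powr_powr)
        finally show ?thesis .
      qed
      ultimately have "ennpowr X (1 / q) \<le> ennreal (2 * C * \<kappa>)"
        by (simp add: ennpowr_def ennreal_leI)
      then have "ennreal (1 / (2 * C)) * ennpowr X (1 / q) \<le> ennreal (1 / (2 * C)) * ennreal (2 * C * \<kappa>)"
        by (rule mult_left_mono) simp
      also have "\<dots> = \<Lambda>" using C lam by (simp add: ennreal_mult[symmetric])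
      finally show ?thesis .
    qed simp
  qed
qed

end
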